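(* Let $d_1,\dots,d_r\in\mathbb{N}$ have greatest common divisor $1$, let $R=\mathbb{R}[t^{d_1},\dots,t^{d_r}]\subseteq\mathbb{R}[t]$, let $c$ be the conductor of $R$ (the smallest integer $c\ge 0$ with $t^d\in R$ for all $d\ge c$), let $D_c$ be the $c$-th Descartes number of $R$, and let $k\geq c$. Every moment functional $L:R_{\leq 2k}\to\mathbb{R}$ is a conic combination of at most $k+1-\left\lceil\frac{c-D_c-1}{2}\right\rceil$ point evaluations. There are moment functionals $L:R_{\leq 2k}\to\mathbb{R}$ that are not a conic combination of less than $k-(c-D_c)$ point evaluations.
   Context: $R_{\leq j}$ denotes the real vector space of polynomials in $R$ of degree at most $j$. The $j$-th Descartes number $D_j$ of $R$ is the maximal number of different real zeros that a nonzero polynomial $f\in R_{\leq j}$ can have. A linear functional $L:R_{\leq 2k}\to\mathbb{R}$ is a moment functional if there is a positive Borel measure $\mu$ on $\mathbb{R}$, with respect to which all elements of $R_{\leq 2k}$ are integrable, such that $L(f)=\int_{\mathbb{R}} f\,d\mu$ for all $f\in R_{\leq 2k}$. Point evaluations are the functionals $l_x(f)=f(x)$ with $x\in\mathbb{R}$; a conic combination is a linear combination with nonnegative coefficients. *)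

theory Defs
  imports "HOL-Analysis.Analysis" "HOL-Computational_Algebra.Polynomial"
begin

inductive_set real_subalgebra :: "real poly set \<Rightarrow> real poly set" for G :: "real poly set" where
  const: "[:a:] \<in> real_subalgebra G"
| gen: "g \<in> G \<Longrightarrow> g \<in> real_subalgebra G"
| add: "p \<in> real_subalgebra G \<Longrightarrow> q \<in> real_subalgebra G \<Longrightarrow> p + q \<in> real_subalgebra G"
| mult: "p \<in> real_subalgebra G \<Longrightarrow> q \<in> real_subalgebra G \<Longrightarrow> p * q \<in> real_subalgebra G"

definition monomial_algebra :: "nat list \<Rightarrow> real poly set" where
  "monomial_algebra ds = real_subalgebra ((\<lambda>d. monom 1 d) ` set ds)"

definition deg_le :: "real poly set \<Rightarrow> nat \<Rightarrow> real poly set" where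
  "deg_le R j = {f \<in> R. degree f \<le> j}"

(* Meaningful when some such c exists; for a monomial algebra, when the gcd of the exponents is 1. *)
definition conductor :: "real poly set \<Rightarrow> nat" where
  "conductor R = (LEAST c. \<forall>d\<ge>c. monom 1 d \<in> R)"

(* The cardinalities are bounded by j, so Max is a genuine maximum as soon as 1 is in R. *)
definition descartes_number :: "real poly set \<Rightarrow> nat \<Rightarrow> nat" where
  "descartes_number R j = Max {card {x. poly f x = 0} | f. f \<in> deg_le R j \<and> f \<noteq> 0}"

(* A functional on V is modelled by a total function of which only the values on V matter. *)
definition linear_functional_on :: "real poly set \<Rightarrow> (real poly \<Rightarrow> real) \<Rightarrow> bool" where
  "linear_functional_on V L \<longleftrightarrow>
     (\<forall>f\<in>V. \<forall>g\<in>V. L (f + g) = L f + L g) \<and> (\<forall>a. \<forall>f\<in>V. L (smult a f) = a * L f)"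

definition moment_functional_on :: "real poly set \<Rightarrow> (real poly \<Rightarrow> real) \<Rightarrow> bool" where
  "moment_functional_on V L \<longleftrightarrow> linear_functional_on V L \<and>
     (\<exists>\<mu> :: real measure. sets \<mu> = sets borel \<and>
        (\<forall>f\<in>V. integrable \<mu> (poly f) \<and> L f = (\<integral>x. poly f x \<partial>\<mu>)))"

definition conic_comb_of_evals_on :: "real poly set \<Rightarrow> real set \<Rightarrow> (real poly \<Rightarrow> real) \<Rightarrow> bool" where
  "conic_comb_of_evals_on V S L \<longleftrightarrow>
     (\<exists>w. (\<forall>x\<in>S. w x \<ge> 0) \<and> (\<forall>f\<in>V. L f = (\<Sum>x\<in>S. w x * poly f x)))"

end

theory Submission
  imports Defs
begin

text \<open>
  Let \<open>E\<close> be the set of all \<open>i\<close> with \<open>t^i\<close> in \<open>R\<close>. Then \<open>R\<close> consists of the polynomials whose exponents lie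
  in \<open>E\<close>, and \<open>E\<close> contains every number from the conductor \<open>c\<close> on.

  The first ingredient is that from the degree \<open>c\<close> on, Descartes numbers grow by exactly one per degree. They
  grow at least that fast because a monomial of higher degree can be added with a small coefficient such that it
  creates a zero near infinity (\<open>add_monomial_gains_zero\<close>). For this one first perturbs the polynomial by a constant, which
  keeps the number of zeros for one of its two signs, even when some zeros are of even order. They do not grow faster
  because differentiation with respect to \<open>1/t\<close> removes the leading term and costs only one zero by Rolle's theorem
  (\<open>differentiation_drops_degree\<close>). A nonnegative polynomial of degree at most \<open>j\<close> in \<open>R\<close> therefore has at most
  \<open>(D + j - c) / 2\<close> different zeros, because its zeros double when it is lowered by a small constant.

  For the upper bound, one looks for a nonnegative \<open>p\<close> in \<open>R\<close> such that \<open>L r \<ge> 0\<close> whenever \<open>r\<close> is nonnegative on the zeros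
  of \<open>p\<close>. Then \<open>L\<close> is a conic combination of evaluations at these zeros, since one can interpolate at them
  inside \<open>R\<close> in degree \<open>2k\<close> (\<open>conic_comb_if_nonneg\<close>). If \<open>L\<close> vanishes on a nonzero nonnegative polynomial, then this polynomial will
  do. Otherwise the problem of minimising \<open>L f\<close> subject to \<open>t^(2k+2) + f \<ge> 0\<close> has a solution by compactness, and
  \<open>p = t^(2k+2) + f\<close> will do, since \<open>f\<close> could be improved in the direction of any \<open>r\<close> that violates the condition
  (\<open>minimiser_nonneg_on_contact_set\<close>). The number of zeros of \<open>p\<close> is at most \<open>(D + 2k + 2 - c) / 2\<close>,
  which implies the claimed bound.

  For the lower bound, take a polynomial \<open>f\<close> of degree at most \<open>k\<close> in \<open>R\<close> with at least \<open>D + k - c\<close> zeros and let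
  \<open>L\<close> be the sum of the evaluations at its zeros. As \<open>L\<close> vanishes on the square of \<open>f\<close>, no other points can occur in a
  representation of \<open>L\<close>, and interpolation shows that none of the zeros can be left out.
\<close>

section \<open>Zeros of perturbed polynomials\<close>

text \<open>\<open>s\<close> is the direction of the perturbation and \<open>\<delta>\<close> its size. The perturbing polynomial \<open>w\<close> is
quantified inside the definition because the proof of \<open>add_monomial_gains_zero\<close> fixes \<open>w\<close> only after it has
compared the gains \<open>n\<close> in the two directions.\<close>
definition gains_zeros :: "real poly \<Rightarrow> real set \<Rightarrow> real set \<Rightarrow> nat \<Rightarrow> real \<Rightarrow> bool" where
  "gains_zeros f Z I n s \<longleftrightarrow>
     (\<forall>w. (\<forall>z\<in>Z. poly w z > 0) \<longrightarrow>
        (\<forall>\<^sub>F \<delta> in at_right 0. \<exists>S\<subseteq>I. finite S \<and> card S = n \<and>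
           (\<forall>x\<in>S. poly (f + smult (s * \<delta>) w) x = 0)))"

lemma gains_zerosD:
  assumes "gains_zeros f Z I n s" "\<And>z. z \<in> Z \<Longrightarrow> poly w z > 0"
  shows "\<forall>\<^sub>F \<delta> in at_right 0. \<exists>S\<subseteq>I. finite S \<and> card S = n \<and>
           (\<forall>x\<in>S. poly (f + smult (s * \<delta>) w) x = 0)"
  using assms unfolding gains_zeros_def by blast

lemma gains_zeros_mono:
  assumes "gains_zeros f Z I n s" "Z \<subseteq> Z'" "I \<subseteq> I'"
  shows "gains_zeros f Z' I' n s"
  unfolding gains_zeros_def
proof (intro allI impI)
  fix w :: "real poly" assume "\<forall>z\<in>Z'. poly w z > 0"
  then have "\<forall>\<^sub>F \<delta> in at_right 0. \<exists>S\<subseteq>I. finite S \<and> card S = n \<and>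
           (\<forall>x\<in>S. poly (f + smult (s * \<delta>) w) x = 0)"
    using assms(2) by (intro gains_zerosD[OF assms(1)]) blast
  then show "\<forall>\<^sub>F \<delta> in at_right 0. \<exists>S\<subseteq>I'. finite S \<and> card S = n \<and>
           (\<forall>x\<in>S. poly (f + smult (s * \<delta>) w) x = 0)"
    by (rule eventually_mono) (use assms(3) in \<open>blast intro: subset_trans\<close>)
qed

lemma tendsto_poly_perturbed:
  fixes f w :: "real poly"
  shows "((\<lambda>\<delta>. poly (f + smult (s * \<delta>) w) x) \<longlongrightarrow> poly f x) (at_right 0)"
proof -
  have "((\<lambda>\<delta>. poly f x + s * \<delta> * poly w x) \<longlongrightarrow> poly f x + s * 0 * poly w x) (at_right 0)"
    by (intro tendsto_intros)
  then show ?thesis by simp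
qed

text \<open>A change of sign between \<open>l\<close> and \<open>r\<close> survives every small perturbation, in both directions.\<close>
lemma gains_zeros_crossing:
  assumes "l < r" "poly f l * poly f r < 0"
  shows "gains_zeros f Z {l<..<r} 1 s"
  unfolding gains_zeros_def
proof (intro allI impI)
  fix w :: "real poly"
  let ?F = "\<lambda>\<delta>. f + smult (s * \<delta>) w"
  have "((\<lambda>\<delta>. poly (?F \<delta>) l * poly (?F \<delta>) r) \<longlongrightarrow> poly f l * poly f r) (at_right 0)"
    by (intro tendsto_mult tendsto_poly_perturbed)
  then have "\<forall>\<^sub>F \<delta> in at_right 0. poly (?F \<delta>) l * poly (?F \<delta>) r < 0"
    by (rule order_tendstoD) (use assms in simp)
  then show "\<forall>\<^sub>F \<delta> in at_right 0. \<exists>S\<subseteq>{l<..<r}. finite S \<and> card S = 1 \<and> (\<forall>x\<in>S. poly (?F \<delta>) x = 0)"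
  proof (rule eventually_mono)
    fix \<delta> assume "poly (?F \<delta>) l * poly (?F \<delta>) r < 0"
    then obtain x where "l < x" "x < r" "poly (?F \<delta>) x = 0"
      using poly_IVT assms(1) by blast
    then show "\<exists>S\<subseteq>{l<..<r}. finite S \<and> card S = 1 \<and> (\<forall>x\<in>S. poly (?F \<delta>) x = 0)"
      by (intro exI[of _ "{x}"]) auto
  qed
qed

text \<open>At \<open>z\<close> the perturbed polynomial has the sign of \<open>s\<close>, while at \<open>l\<close> and \<open>r\<close> it
keeps the opposite sign of \<open>f\<close>. Hence there is one zero on each side of \<open>z\<close>.\<close>
lemma gains_zeros_touching:
  assumes "l < z" "z < r" "poly f z = 0" "s * poly f l < 0" "s * poly f r < 0"
  shows "gains_zeros f {z} {l<..<r} 2 s"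
  unfolding gains_zeros_def
proof (intro allI impI)
  fix w :: "real poly"
  assume "\<forall>y\<in>{z}. poly w y > 0"
  then have w: "poly w z > 0" by simp
  have s: "s \<noteq> 0" using assms(4) by auto
  let ?F = "\<lambda>\<delta>. f + smult (s * \<delta>) w"
  have ev: "\<forall>\<^sub>F \<delta> in at_right 0. s * poly (?F \<delta>) y < 0" if "s * poly f y < 0" for y
    by (rule order_tendstoD[OF tendsto_mult[OF tendsto_const tendsto_poly_perturbed]]) (use that in simp)
  show "\<forall>\<^sub>F \<delta> in at_right 0. \<exists>S\<subseteq>{l<..<r}. finite S \<and> card S = 2 \<and> (\<forall>x\<in>S. poly (?F \<delta>) x = 0)"
    using ev[OF assms(4)] ev[OF assms(5)] eventually_at_right_less[of 0]
  proof eventually_elim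
    case (elim \<delta>)
    have "s * poly (?F \<delta>) z = s * s * (\<delta> * poly w z)" using assms(3) by simp
    also have "\<dots> > 0" using s w elim(3) by (intro mult_pos_pos[of "s * s"]) (auto simp: zero_less_mult_iff)
    finally have Fz: "s * poly (?F \<delta>) z > 0" .
    have "poly (?F \<delta>) l * poly (?F \<delta>) z < 0" "poly (?F \<delta>) z * poly (?F \<delta>) r < 0"
      using elim(1,2) Fz by (auto simp: mult_less_0_iff zero_less_mult_iff simp del: poly_add poly_smult)
    then obtain x y where "l < x" "x < z" "poly (?F \<delta>) x = 0" "z < y" "y < r" "poly (?F \<delta>) y = 0"
      using poly_IVT assms(1,2) by meson
    then show ?case by (intro exI[of _ "{x,y}"]) auto
  qed
qed

lemma gains_zeros_0: "gains_zeros f Z I 0 s"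
  unfolding gains_zeros_def by (intro allI impI always_eventually exI[of _ "{}"]) auto

text \<open>If \<open>f\<close> changes sign at \<open>z\<close>, then each direction of perturbation keeps one zero. Otherwise
one direction turns \<open>z\<close> into two zeros and the other one may lose it. On average over the two directions
no zero is lost, which is recorded by \<open>a + b = 2\<close>.\<close>
lemma zero_splits:
  assumes "l < z" "z < r" "poly f z = 0" "poly f l \<noteq> 0" "poly f r \<noteq> 0"
  obtains a b where "a + b = 2" "gains_zeros f {z} {l<..<r} a 1" "gains_zeros f {z} {l<..<r} b (-1)"
proof -
  consider "poly f l * poly f r < 0" | "poly f l > 0" "poly f r > 0" | "poly f l < 0" "poly f r < 0"
    using assms(4,5) by (auto simp: mult_less_0_iff) (meson linorder_neqE_linordered_idom)+
  then show thesis
  proof cases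
    case 1
    with assms show thesis by (intro that[of 1 1] gains_zeros_crossing) auto
  next
    case 2
    with assms show thesis by (intro that[of 0 2] gains_zeros_0 gains_zeros_touching) auto
  next
    case 3
    with assms show thesis by (intro that[of 2 0] gains_zeros_0 gains_zeros_touching) auto
  qed
qed

lemma gains_zeros_UN:
  assumes "finite Z" and disj: "\<And>y z. y \<in> Z \<Longrightarrow> z \<in> Z \<Longrightarrow> y \<noteq> z \<Longrightarrow> I y \<inter> I z = {}"
    and g: "\<And>z. z \<in> Z \<Longrightarrow> gains_zeros f {z} (I z) (n z) s"
  shows "gains_zeros f Z (\<Union>z\<in>Z. I z) (\<Sum>z\<in>Z. n z) s"
  unfolding gains_zeros_def
proof (intro allI impI)
  fix w :: "real poly"
  assume w: "\<forall>z\<in>Z. poly w z > 0"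
  have "\<forall>\<^sub>F \<delta> in at_right 0. \<forall>z\<in>Z. \<exists>S\<subseteq>I z. finite S \<and> card S = n z \<and>
           (\<forall>x\<in>S. poly (f + smult (s * \<delta>) w) x = 0)"
    using w by (intro eventually_ball_finite ballI assms(1) gains_zerosD[OF g]) auto
  then show "\<forall>\<^sub>F \<delta> in at_right 0. \<exists>S\<subseteq>\<Union>z\<in>Z. I z. finite S \<and> card S = (\<Sum>z\<in>Z. n z) \<and>
           (\<forall>x\<in>S. poly (f + smult (s * \<delta>) w) x = 0)"
  proof (rule eventually_mono)
    fix \<delta>
    assume "\<forall>z\<in>Z. \<exists>S\<subseteq>I z. finite S \<and> card S = n z \<and> (\<forall>x\<in>S. poly (f + smult (s * \<delta>) w) x = 0)"
    then obtain S where S: "\<And>z. z \<in> Z \<Longrightarrow> S z \<subseteq> I z \<and> finite (S z) \<and> card (S z) = n z \<and>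
        (\<forall>x\<in>S z. poly (f + smult (s * \<delta>) w) x = 0)"
      by metis
    have "card (\<Union>z\<in>Z. S z) = (\<Sum>z\<in>Z. n z)"
      using assms(1) S disj by (subst card_UN_disjoint) (auto, blast)
    with S assms(1) show "\<exists>S\<subseteq>\<Union>z\<in>Z. I z. finite S \<and> card S = (\<Sum>z\<in>Z. n z) \<and>
           (\<forall>x\<in>S. poly (f + smult (s * \<delta>) w) x = 0)"
      by (intro exI[of _ "\<Union>z\<in>Z. S z"]) blast
  qed
qed

lemma finite_set_separated:
  fixes Z :: "real set"
  assumes "finite Z"
  obtains \<rho> where "\<rho> > 0" "\<And>y z. y \<in> Z \<Longrightarrow> z \<in> Z \<Longrightarrow> y \<noteq> z \<Longrightarrow> 2 * \<rho> < \<bar>y - z\<bar>"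
proof -
  have "\<forall>\<^sub>F \<rho> in at_right 0. \<forall>y\<in>Z. \<forall>z\<in>Z. y \<noteq> z \<longrightarrow> 2 * \<rho> < \<bar>y - z\<bar>"
  proof (intro eventually_ball_finite assms ballI)
    fix y z :: real
    show "\<forall>\<^sub>F \<rho> in at_right 0. y \<noteq> z \<longrightarrow> 2 * \<rho> < \<bar>y - z\<bar>"
    proof (cases "y = z")
      case False
      have "((\<lambda>\<rho>. 2 * \<rho>) \<longlongrightarrow> 2 * (0::real)) (at_right 0)" by (intro tendsto_intros)
      then have "\<forall>\<^sub>F \<rho> in at_right 0. 2 * \<rho> < \<bar>y - z\<bar>" by (rule order_tendstoD) (use False in simp)
      then show ?thesis by (rule eventually_mono) simp
    qed simp
  qed
  then have "\<forall>\<^sub>F \<rho> in at_right 0. \<rho> > 0 \<and> (\<forall>y\<in>Z. \<forall>z\<in>Z. y \<noteq> z \<longrightarrow> 2 * \<rho> < \<bar>y - z\<bar>)"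
    using eventually_at_right_less[of 0] by eventually_elim auto
  then obtain \<rho> where "\<rho> > 0 \<and> (\<forall>y\<in>Z. \<forall>z\<in>Z. y \<noteq> z \<longrightarrow> 2 * \<rho> < \<bar>y - z\<bar>)"
    using eventually_happens' trivial_limit_at_right_real by blast
  then show thesis using that by blast
qed

lemma isolating_intervals:
  fixes f :: "real poly"
  assumes "f \<noteq> 0"
  obtains \<rho> where "\<rho> > 0"
    and "\<And>z. poly f z = 0 \<Longrightarrow> poly f (z - \<rho>) \<noteq> 0 \<and> poly f (z + \<rho>) \<noteq> 0"
    and "\<And>y z. y \<in> {z. poly f z = 0} \<Longrightarrow> z \<in> {z. poly f z = 0} \<Longrightarrow> y \<noteq> z \<Longrightarrow> {y-\<rho><..<y+\<rho>} \<inter> {z-\<rho><..<z+\<rho>} = {}"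
proof -
  obtain \<rho> where \<rho>: "\<rho> > 0"
    and sep: "\<And>y z. poly f y = 0 \<Longrightarrow> poly f z = 0 \<Longrightarrow> y \<noteq> z \<Longrightarrow> 2 * \<rho> < \<bar>y - z\<bar>"
    using finite_set_separated[OF poly_roots_finite[OF assms]] by auto
  show thesis
  proof
    show "\<rho> > 0" by (rule \<rho>)
    show "poly f (z - \<rho>) \<noteq> 0 \<and> poly f (z + \<rho>) \<noteq> 0" if "poly f z = 0" for z
      using sep[of z "z - \<rho>"] sep[of z "z + \<rho>"] that \<rho> by auto
    show "{y-\<rho><..<y+\<rho>} \<inter> {z-\<rho><..<z+\<rho>} = {}" 
      if "y \<in> {z. poly f z = 0}" "z \<in> {z. poly f z = 0}" "y \<noteq> z" for y z
    proof (intro equals0I)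
      fix x assume "x \<in> {y-\<rho><..<y+\<rho>} \<inter> {z-\<rho><..<z+\<rho>}"
      then have "\<bar>y - z\<bar> < 2 * \<rho>" by (auto simp: abs_less_iff)
      with sep[of y z] that show False by simp
    qed
  qed
qed

lemma bounded_isolating_intervals:
  fixes Z :: "real set"
  assumes "finite Z"
  obtains Y where "(\<Union>z\<in>Z. {z-\<rho><..<z+\<rho>}) \<subseteq> {..<Y}" "\<And>z. z \<in> Z \<Longrightarrow> z < Y"
proof -
  have "bdd_above (insert 0 Z)" using assms by (intro bdd_above_finite) auto
  then obtain M where M: "\<And>z. z \<in> Z \<Longrightarrow> z \<le> M" by (auto simp: bdd_above_def)
  show thesis
    by (rule that[of "M + \<bar>\<rho>\<bar> + 1"]) (use M in \<open>fastforce+\<close>)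
qed

text \<open>The zeros are treated separately in disjoint intervals and the counts of \<open>zero_splits\<close> are
added. One of \<open>A\<close> and \<open>B\<close> is therefore at least the number of zeros of \<open>f\<close>. All these zeros stay
to the left of a point \<open>Y\<close>, so that a zero found to the right of \<open>Y\<close> is a further one.\<close>
lemma zeros_under_perturbation:
  assumes "f \<noteq> 0"
  obtains A B Y where "A + B = 2 * card {z. poly f z = 0}"
    "gains_zeros f {z. poly f z = 0} {..<Y} A 1" "gains_zeros f {z. poly f z = 0} {..<Y} B (-1)"
    "\<And>z. poly f z = 0 \<Longrightarrow> z < Y"
proof -
  let ?Z = "{z. poly f z = 0}"
  have fin: "finite ?Z" using assms by (rule poly_roots_finite)
  obtain \<rho> where \<rho>: "\<rho> > 0"
    and nz: "\<And>z. poly f z = 0 \<Longrightarrow> poly f (z - \<rho>) \<noteq> 0 \<and> poly f (z + \<rho>) \<noteq> 0"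
    and disj: "\<And>y z. y \<in> ?Z \<Longrightarrow> z \<in> ?Z \<Longrightarrow> y \<noteq> z \<Longrightarrow> {y-\<rho><..<y+\<rho>} \<inter> {z-\<rho><..<z+\<rho>} = {}"
    using isolating_intervals[OF assms] by blast
  obtain Y where Y: "(\<Union>z\<in>?Z. {z-\<rho><..<z+\<rho>}) \<subseteq> {..<Y}" "\<And>z. z \<in> ?Z \<Longrightarrow> z < Y"
    using bounded_isolating_intervals[OF fin] by blast
  have "\<exists>a b. a + b = 2 \<and> gains_zeros f {z} {z-\<rho><..<z+\<rho>} a 1 \<and> gains_zeros f {z} {z-\<rho><..<z+\<rho>} b (-1)"
    if "z \<in> ?Z" for z
    by (rule zero_splits[of "z - \<rho>" z "z + \<rho>" f]) (use \<rho> nz[of z] that in auto)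
  then obtain a b where ab: "\<And>z. z \<in> ?Z \<Longrightarrow> a z + b z = 2"
    "\<And>z. z \<in> ?Z \<Longrightarrow> gains_zeros f {z} {z-\<rho><..<z+\<rho>} (a z) 1"
    "\<And>z. z \<in> ?Z \<Longrightarrow> gains_zeros f {z} {z-\<rho><..<z+\<rho>} (b z) (-1)"
    by metis
  show thesis
  proof
    have "sum a ?Z + sum b ?Z = (\<Sum>z\<in>?Z. 2)"
      unfolding sum.distrib[symmetric] using ab(1) by (intro sum.cong) auto
    then show "sum a ?Z + sum b ?Z = 2 * card ?Z" by simp
    show "gains_zeros f ?Z {..<Y} (sum a ?Z) 1"
      by (rule gains_zeros_mono[OF gains_zeros_UN[OF fin disj ab(2)] subset_refl Y(1)])
    show "gains_zeros f ?Z {..<Y} (sum b ?Z) (-1)"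
      by (rule gains_zeros_mono[OF gains_zeros_UN[OF fin disj ab(3)] subset_refl Y(1)])
    show "\<And>z. poly f z = 0 \<Longrightarrow> z < Y" using Y(2) by blast
  qed
qed

text \<open>A nonnegative polynomial touches the axis at each of its zeros, and lowering it splits all of
them into two.\<close>
lemma zeros_double_under_lowering:
  assumes "f \<noteq> 0" "\<And>x. poly f x \<ge> 0"
  shows "gains_zeros f {z. poly f z = 0} UNIV (2 * card {z. poly f z = 0}) (-1)"
proof -
  let ?Z = "{z. poly f z = 0}"
  have fin: "finite ?Z" using assms(1) by (rule poly_roots_finite)
  obtain \<rho> where \<rho>: "\<rho> > 0"
    and nz: "\<And>z. poly f z = 0 \<Longrightarrow> poly f (z - \<rho>) \<noteq> 0 \<and> poly f (z + \<rho>) \<noteq> 0"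
    and disj: "\<And>y z. y \<in> ?Z \<Longrightarrow> z \<in> ?Z \<Longrightarrow> y \<noteq> z \<Longrightarrow> {y-\<rho><..<y+\<rho>} \<inter> {z-\<rho><..<z+\<rho>} = {}"
    using isolating_intervals[OF assms(1)] by blast
  have "gains_zeros f {z} {z-\<rho><..<z+\<rho>} 2 (-1)" if "z \<in> ?Z" for z
    by (rule gains_zeros_touching)
      (use that \<rho> nz[of z] assms(2)[of "z - \<rho>"] assms(2)[of "z + \<rho>"] in auto)
  from gains_zeros_mono[OF gains_zeros_UN[OF fin disj this] subset_refl subset_UNIV]
  have "gains_zeros f ?Z UNIV (\<Sum>z\<in>?Z. 2) (-1)" .
  then show ?thesis by (simp add: mult.commute)
qed

section \<open>Polynomials with prescribed exponents\<close>

definition supported_on :: "nat set \<Rightarrow> real poly set" where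
  "supported_on F = {f. \<forall>i. coeff f i \<noteq> 0 \<longrightarrow> i \<in> F}"

lemma supported_on_monom [simp]: "i \<in> F \<Longrightarrow> monom a i \<in> supported_on F"
  by (auto simp: supported_on_def)

lemma supported_on_0 [simp]: "0 \<in> supported_on F"
  by (auto simp: supported_on_def)

lemma supported_on_const: "0 \<in> F \<Longrightarrow> [:a:] \<in> supported_on F"
  using supported_on_monom[of 0 F a] by (simp add: monom_0)

lemma supported_on_1 [simp]: "0 \<in> F \<Longrightarrow> 1 \<in> supported_on F"
  unfolding one_pCons by (rule supported_on_const)

lemma supported_on_add [simp]: "f \<in> supported_on F \<Longrightarrow> g \<in> supported_on F \<Longrightarrow> f + g \<in> supported_on F"
  unfolding supported_on_def by force

lemma supported_on_smult [simp]: "f \<in> supported_on F \<Longrightarrow> smult a f \<in> supported_on F"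
  by (auto simp: supported_on_def)

lemma supported_on_diff [simp]: "f \<in> supported_on F \<Longrightarrow> g \<in> supported_on F \<Longrightarrow> f - g \<in> supported_on F"
  using supported_on_add[OF _ supported_on_smult[of g F "-1"]] by simp

lemma supported_on_sum: "(\<And>x. x \<in> A \<Longrightarrow> f x \<in> supported_on F) \<Longrightarrow> sum f A \<in> supported_on F"
  by (induction A rule: infinite_finite_induct) auto

lemma supported_on_mono: "F \<subseteq> G \<Longrightarrow> supported_on F \<subseteq> supported_on G"
  by (auto simp: supported_on_def)

lemma deg_le_supported_on: "deg_le (supported_on E) j = supported_on (E \<inter> {..j})"
  unfolding deg_le_def supported_on_def
  by (auto dest: le_degree intro!: degree_le simp: le_trans[OF le_degree])

lemma degree_supported_on: "f \<in> supported_on (E \<inter> {..j}) \<Longrightarrow> degree f \<le> j"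
  unfolding deg_le_supported_on[symmetric] deg_le_def by simp

section \<open>Adding a monomial and removing the leading one\<close>

lemma zero_beyond:
  fixes g :: "real poly"
  assumes "lead_coeff g * poly g Y < 0"
  obtains x where "x > Y" "poly g x = 0"
proof -
  have *: "\<exists>x>Y. poly h x = 0" if "lead_coeff h > 0" "poly h Y < 0" for h :: "real poly"
  proof -
    obtain n where n: "\<And>x. x \<ge> n \<Longrightarrow> poly h x \<ge> lead_coeff h"
      using poly_pinfty_gt_lc[of h] \<open>lead_coeff h > 0\<close> by blast
    have "poly h (max n (Y + 1)) > 0" using n[of "max n (Y + 1)"] that(1) by simp
    then show ?thesis using poly_IVT_pos[of Y "max n (Y + 1)" h] that(2)
      by (metis less_add_one max.strict_coboundedI2)
  qed
  show thesis
  proof (cases "lead_coeff g > 0")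
    case True
    with assms have "poly g Y < 0" by (simp add: mult_less_0_iff)
    with * True that show thesis by blast
  next
    case False
    with assms have "lead_coeff (-g) > 0" "poly (-g) Y < 0" by (auto simp: mult_less_0_iff)
    from *[OF this] that show thesis by auto
  qed
qed

lemma small_monomial:
  fixes Z :: "real set"
  assumes "finite Z"
  shows "\<forall>\<^sub>F \<eta> in at_right 0. \<forall>z\<in>Z. poly (1 + monom (s * \<eta>) m) z > 0"
proof (intro eventually_ball_finite assms ballI)
  fix z assume "z \<in> Z"
  have "((\<lambda>\<eta>. 1 + s * \<eta> * z ^ m) \<longlongrightarrow> 1 + s * 0 * z ^ m) (at_right 0)" by (intro tendsto_intros)
  then have "\<forall>\<^sub>F \<eta> in at_right 0. 1 + s * \<eta> * z ^ m > 0" by (rule order_tendstoD) simp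
  then show "\<forall>\<^sub>F \<eta> in at_right 0. poly (1 + monom (s * \<eta>) m) z > 0" by (simp add: poly_monom)
qed

text \<open>Perturb \<open>f\<close> by a small multiple of \<open>1 + \<eta> t^m\<close>. The constant part, taken in the better of its
two directions, keeps as many zeros as \<open>f\<close> has. The monomial is so small that it does not disturb them,
but it dominates far to the right, and its sign is chosen such that this forces one more zero there.\<close>
lemma add_monomial_gains_zero:
  assumes f: "f \<in> supported_on E" "f \<noteq> 0" "degree f < m" and E: "0 \<in> E" "m \<in> E"
  obtains g where "g \<in> supported_on E" "degree g = m" 
    "card {x. poly f x = 0} + 1 \<le> card {x. poly g x = 0}"
proof -
  let ?Z = "{x. poly f x = 0}"
  have fin: "finite ?Z" using f(2) by (rule poly_roots_finite)
  obtain A B Y where AB: "A + B = 2 * card ?Z"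
    "gains_zeros f ?Z {..<Y} A 1" "gains_zeros f ?Z {..<Y} B (-1)" and Y: "\<And>z. z \<in> ?Z \<Longrightarrow> z < Y"
    using zeros_under_perturbation[OF f(2)] by (metis (mono_tags, lifting) mem_Collect_eq)
  obtain s n where s: "s \<in> {1,-1}" and n: "n \<ge> card ?Z" and gain: "gains_zeros f ?Z {..<Y} n s"
  proof (cases "A \<ge> card ?Z")
    case True then show thesis using that[of 1 A] AB(2) by simp
  next
    case False then show thesis using that[of "-1" B] AB(1,3) by simp
  qed
  have fY: "poly f Y \<noteq> 0" using Y by force
  \<comment> \<open>The leading coefficient \<open>s \<delta> t \<eta>\<close> of \<open>g\<close> below has the sign opposite to \<open>f\<close> at \<open>Y\<close>.\<close>
  define t where "t = - s * poly f Y"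
  have t: "t \<noteq> 0" using fY s by (auto simp: t_def)
  have "\<forall>\<^sub>F \<eta> in at_right 0. \<eta> > 0 \<and> (\<forall>z\<in>?Z. poly (1 + monom (t * \<eta>) m) z > 0)"
    using eventually_at_right_less[of 0] small_monomial[OF fin, of t m] by eventually_elim simp
  then obtain \<eta> where \<eta>: "\<eta> > 0" "\<And>z. z \<in> ?Z \<Longrightarrow> poly (1 + monom (t * \<eta>) m) z > 0"
    using eventually_happens' trivial_limit_at_right_real by blast
  define w where "w = 1 + monom (t * \<eta>) m"
  let ?F = "\<lambda>\<delta>. f + smult (s * \<delta>) w"
  have "((\<lambda>\<delta>. poly (?F \<delta>) Y * poly f Y) \<longlongrightarrow> poly f Y * poly f Y) (at_right 0)"
    by (intro tendsto_mult tendsto_poly_perturbed tendsto_const)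
  then have "\<forall>\<^sub>F \<delta> in at_right 0. poly (?F \<delta>) Y * poly f Y > 0"
    by (rule order_tendstoD) (use fY in \<open>simp add: zero_less_mult_iff linorder_neq_iff disj_commute\<close>)
  moreover have "\<forall>\<^sub>F \<delta> in at_right 0. \<exists>S\<subseteq>{..<Y}. finite S \<and> card S = n \<and> (\<forall>x\<in>S. poly (?F \<delta>) x = 0)"
    using gains_zerosD[OF gain, of w] \<eta>(2) by (simp add: w_def)
  ultimately have "\<forall>\<^sub>F \<delta> in at_right 0. \<delta> > 0 \<and> poly (?F \<delta>) Y * poly f Y > 0 \<and>
      (\<exists>S\<subseteq>{..<Y}. finite S \<and> card S = n \<and> (\<forall>x\<in>S. poly (?F \<delta>) x = 0))"
    using eventually_at_right_less[of 0] by eventually_elim simp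
  then obtain \<delta> S where \<delta>: "\<delta> > 0" "poly (?F \<delta>) Y * poly f Y > 0"
    and S: "S \<subseteq> {..<Y}" "finite S" "card S = n" "\<forall>x\<in>S. poly (?F \<delta>) x = 0"
    using eventually_happens' trivial_limit_at_right_real by blast
  define g where "g = ?F \<delta>"
  have m: "m > 0" using f(3) by simp
  have cm: "coeff g m = s * \<delta> * (t * \<eta>)"
    using f(3) m by (simp add: g_def w_def coeff_eq_0)
  have "degree g \<le> m" unfolding g_def w_def
    using f(3) m by (intro degree_add_le degree_smult_le[THEN order_trans]) (auto simp: degree_monom_le)
  moreover have "coeff g m \<noteq> 0" using cm s t \<delta>(1) \<eta>(1) by auto
  ultimately have deg: "degree g = m" using le_degree by (metis antisym)
  have "lead_coeff g * poly f Y = - (s * s) * (\<delta> * \<eta> * (poly f Y * poly f Y))"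
    unfolding deg cm t_def by (simp add: algebra_simps)
  also have "\<dots> < 0" using s \<delta>(1) \<eta>(1) fY by (auto simp: zero_less_mult_iff linorder_neq_iff)
  finally have "lead_coeff g * poly g Y < 0"
    using \<delta>(2) unfolding g_def[symmetric] by (auto simp: mult_less_0_iff zero_less_mult_iff)
  then obtain x where x: "x > Y" "poly g x = 0" using zero_beyond by blast
  have g0: "g \<noteq> 0" using deg m by auto
  have "card (insert x S) = n + 1" using S x by (subst card_insert_disjoint) auto
  moreover have "card (insert x S) \<le> card {x. poly g x = 0}"
    using S(4) x by (intro card_mono poly_roots_finite g0) (auto simp: g_def)
  ultimately have "card ?Z + 1 \<le> card {x. poly g x = 0}" using n by simp
  moreover have "g \<in> supported_on E" 
    unfolding g_def w_def using f(1) E by simp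
  ultimately show thesis using that deg by blast
qed

text \<open>The bound by \<open>Max U\<close> makes the induction work: the zero of the derivative that is found between
\<open>Max U\<close> and a new largest zero is then a new one.\<close>
lemma Rolle_count:
  fixes F :: "real poly"
  assumes "finite U" "\<And>u. u \<in> U \<Longrightarrow> poly F u = 0" "U \<noteq> {}"
  shows "\<exists>T. finite T \<and> card T + 1 = card U \<and> (\<forall>t\<in>T. poly (pderiv F) t = 0) \<and> (\<forall>t\<in>T. t < Max U)"
  using assms
proof (induction U rule: finite_linorder_max_induct)
  case (insert b U)
  show ?case
  proof (cases "U = {}")
    case True
    then show ?thesis by (intro exI[of _ "{}"]) auto
  next
    case False
    with insert obtain T where T: "finite T" "card T + 1 = card U" "\<forall>t\<in>T. poly (pderiv F) t = 0"
      "\<forall>t\<in>T. t < Max U"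
      by auto
    have lt: "Max U < b" using insert False by simp
    have "poly F (Max U) = 0" "poly F b = 0" using insert.prems(1) Max_in[OF insert.hyps(1) False] by auto
    then obtain x where x: "Max U < x" "x < b" "poly (pderiv F) x = 0"
      using poly_MVT[OF lt, of F] by auto
    have "Max (insert b U) = b" using insert False lt by simp
    moreover have "card (insert x T) = card T + 1" using T x by (subst card_insert_disjoint) auto
    moreover have "card (insert b U) = card U + 1" using insert by (subst card_insert_disjoint) auto
    ultimately show ?thesis using T x lt by (intro exI[of _ "insert x T"]) force
  qed
qed simp

text \<open>In the coordinate \<open>u = 1/t\<close> at infinity, \<open>f\<close> becomes \<open>reflect_poly f\<close>, and this is the derivative
with respect to \<open>u\<close>, written in \<open>t\<close> again. It rescales each coefficient of \<open>f\<close>, so no new exponent appears, and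
it removes the leading one.\<close>
definition deriv_at_infinity :: "real poly \<Rightarrow> real poly" where
  "deriv_at_infinity f = smult (degree f) f - pCons 0 (pderiv f)"

lemma coeff_deriv_at_infinity: "coeff (deriv_at_infinity f) i = (real (degree f) - real i) * coeff f i"
  by (cases i) (auto simp: deriv_at_infinity_def coeff_pderiv algebra_simps)

lemma poly_deriv_at_infinity:
  assumes "u \<noteq> 0" "degree f = Suc j"
  shows "poly (pderiv (reflect_poly f)) u = u ^ j * poly (deriv_at_infinity f) (inverse u)"
proof -
  have "(poly (reflect_poly f) has_field_derivative poly (pderiv (reflect_poly f)) u) (at u)"
    by (rule poly_DERIV)
  moreover have aux: "((\<lambda>u. u ^ Suc j * poly f (inverse u)) has_field_derivative 
      (real (Suc j) * u ^ j) * poly f (inverse u) + (poly (pderiv f) (inverse u) * - (inverse u ^ 2)) * u ^ Suc j) (at u)"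
    using assms(1) DERIV_power[OF DERIV_ident, of "Suc j" u UNIV]
    by (intro DERIV_mult DERIV_chain'[OF _ poly_DERIV]) (auto intro!: derivative_eq_intros simp: power2_eq_square)
  from aux have "(poly (reflect_poly f) has_field_derivative 
      (real (Suc j) * u ^ j) * poly f (inverse u) + (poly (pderiv f) (inverse u) * - (inverse u ^ 2)) * u ^ Suc j) (at u)"
    by (rule has_field_derivative_transform_within_open[where S="-{0}"])
      (use assms in \<open>auto simp: poly_reflect_poly_nz\<close>)
  ultimately have "poly (pderiv (reflect_poly f)) u = 
     (real (Suc j) * u ^ j) * poly f (inverse u) + (poly (pderiv f) (inverse u) * - (inverse u ^ 2)) * u ^ Suc j"
    by (rule DERIV_unique)
  also have "\<dots> = u ^ j * poly (deriv_at_infinity f) (inverse u)"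
    using assms by (simp add: deriv_at_infinity_def field_simps power2_eq_square)
  finally show ?thesis .
qed

text \<open>Rolle's theorem is applied to the reversal of \<open>f\<close>, whose zeros are the inverses of the nonzero
zeros of \<open>f\<close>. In this coordinate \<open>0\<close> does not separate the positive from the negative zeros, so only one zero is
lost, and a zero of \<open>f\<close> at \<open>0\<close> is kept because the coefficients are only rescaled. If one of the zeros from Rolle's theorem is
\<open>u = 0\<close>, it corresponds to no real number, but then the degree has dropped by at least two and
\<open>add_monomial_gains_zero\<close> makes up for the loss.\<close>
lemma differentiation_drops_degree:
  assumes f: "f \<in> supported_on E" "degree f = Suc j" and E: "0 \<in> E" "j \<in> E"
  obtains g where "g \<in> supported_on E" "g \<noteq> 0" "degree g \<le> j"
    "card {x. poly f x = 0} \<le> card {x. poly g x = 0} + 1"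
proof (cases "deriv_at_infinity f = 0")
  case True
  have "coeff f i = 0" if "i \<noteq> Suc j" for i
    using arg_cong[OF True, of "\<lambda>p. coeff p i"] that f(2) by (simp add: coeff_deriv_at_infinity)
  then have "f = monom (lead_coeff f) (Suc j)"
    by (intro poly_eqI) (auto simp: f(2))
  then have "poly f x = lead_coeff f * x ^ Suc j" for x by (metis poly_monom)
  moreover have "lead_coeff f \<noteq> 0" using f(2) by (metis degree_0 leading_coeff_0_iff nat.distinct(1))
  ultimately have "{x. poly f x = 0} \<subseteq> {0}" by auto
  then have "card {x. poly f x = 0} \<le> 1" using card_mono[of "{0}" "{x. poly f x = 0}"] by simp
  then show thesis using E(1) by (intro that[of 1]) auto
next
  case False
  let ?F = "reflect_poly f" and ?g = "deriv_at_infinity f"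
  define U where "U = inverse ` ({x. poly f x = 0} - {0})"
  define Z0 where "Z0 = {x. poly f x = 0} \<inter> {0}"
  have f0: "f \<noteq> 0" using f(2) degree_0 by fastforce
  have fin: "finite {x. poly f x = 0}" using f0 by (rule poly_roots_finite)
  have cardU: "card U = card ({x. poly f x = 0} - {0})"
    unfolding U_def by (intro card_image inj_onI) simp
  have cardf: "card {x. poly f x = 0} = card U + card Z0"
    unfolding cardU Z0_def
    using card_Diff_subset_Int[of "{x. poly f x = 0}" "{0}"] card_mono[OF fin, of "{x. poly f x = 0} \<inter> {0}"]
    by auto
  have FU: "poly ?F u = 0" if "u \<in> U" for u
  proof -
    have "u \<noteq> 0" "poly f (inverse u) = 0" using that by (auto simp: U_def)
    then show ?thesis by (simp add: poly_reflect_poly_nz)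
  qed
  obtain T where T: "finite T" "card U \<le> card T + 1" "\<And>t. t \<in> T \<Longrightarrow> poly (pderiv ?F) t = 0"
  proof (cases "U = {}")
    case True then show thesis using that[of "{}"] by simp
  next
    case False
    have "finite U" using fin by (simp add: U_def)
    from Rolle_count[OF this FU False] show thesis using that by force
  qed
  have gE: "?g \<in> supported_on E"
    using f(1) by (auto simp: supported_on_def coeff_deriv_at_infinity)
  have degg: "degree ?g \<le> j"
  proof (intro degree_le allI impI)
    fix i assume "j < i"
    then show "coeff ?g i = 0" by (cases "i = Suc j") (auto simp: coeff_deriv_at_infinity f(2) coeff_eq_0)
  qed
  have zg: "poly ?g (inverse t) = 0" if "t \<in> T" "t \<noteq> 0" for t
    using T(3)[OF that(1)] poly_deriv_at_infinity[OF that(2) f(2)] that(2) by simp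
  have z0: "poly ?g x = 0" if "x \<in> Z0" for x
    using that by (auto simp: Z0_def poly_0_coeff_0 coeff_deriv_at_infinity)
  have "card (T - {0}) + card Z0 = card (inverse ` (T - {0}) \<union> Z0)"
    using T(1) by (subst card_Un_disjoint) (auto simp: Z0_def card_image inj_on_def)
  also have "\<dots> \<le> card {x. poly ?g x = 0}"
    using zg z0 by (intro card_mono poly_roots_finite False) auto
  finally have cardg: "card (T - {0}) + card Z0 \<le> card {x. poly ?g x = 0}" .
  show thesis
  proof (cases "0 \<in> T")
    case False
    then have "T - {0} = T" by auto
    with cardg T(2) cardf show thesis using that[OF gE \<open>?g \<noteq> 0\<close> degg] by simp
  next
    case True
    \<comment> \<open>The value of \<open>pderiv (reflect_poly f)\<close> at \<open>0\<close> is the coefficient of \<open>t^j\<close> in \<open>f\<close>.\<close>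
    have "coeff f j = 0"
      using T(3)[OF True] by (simp add: poly_0_coeff_0 coeff_pderiv coeff_reflect_poly f(2))
    then have "coeff ?g j = 0" by (simp add: coeff_deriv_at_infinity)
    then have "degree ?g < j" using degg False by (metis leading_coeff_0_iff order_le_less)
    from add_monomial_gains_zero[OF gE False this E]
    obtain h where h: "h \<in> supported_on E" "degree h = j" "card {x. poly ?g x = 0} + 1 \<le> card {x. poly h x = 0}" .
    have "h \<noteq> 0"
    proof
      assume "h = 0"
      with h(2) \<open>degree ?g < j\<close> show False by simp
    qed
    moreover have "card T = card (T - {0}) + 1" using True T(1) by (metis Suc_eq_plus1 card.remove)
    ultimately show thesis using that[OF h(1)] h(2,3) cardg T(2) cardf by simp
  qed
qed

text \<open>Each degree beyond \<open>c\<close> is removed by \<open>differentiation_drops_degree\<close> at the price of one zero.\<close>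
lemma number_of_zeros_le:
  assumes E: "0 \<in> E" "{c..} \<subseteq> E"
    and D: "\<And>f. f \<in> supported_on E \<Longrightarrow> f \<noteq> 0 \<Longrightarrow> degree f \<le> c \<Longrightarrow> card {x. poly f x = 0} \<le> D"
    and "f \<in> supported_on E" "f \<noteq> 0" "degree f \<le> c + i"
  shows "card {x. poly f x = 0} \<le> D + i"
  using assms(4-6)
proof (induction i arbitrary: f)
  case 0
  then show ?case using D by simp
next
  case (Suc i)
  show ?case
  proof (cases "degree f = Suc (c + i)")
    case True
    have "c + i \<in> E" using E(2) by auto
    from differentiation_drops_degree[OF Suc.prems(1) True E(1) this]
    obtain g where "g \<in> supported_on E" "g \<noteq> 0" "degree g \<le> c + i"
      "card {x. poly f x = 0} \<le> card {x. poly g x = 0} + 1" .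
    with Suc.IH[of g] show ?thesis by simp
  next
    case False
    with Suc.prems(3) have "degree f \<le> c + i" by simp
    from Suc.IH[OF Suc.prems(1,2) this] show ?thesis by simp
  qed
qed

text \<open>Lowering \<open>p\<close> doubles its zeros and does not leave the algebra, since constants belong to it.\<close>
lemma number_of_zeros_nonneg_le:
  assumes E: "0 \<in> E" "{c..} \<subseteq> E"
    and D: "\<And>f. f \<in> supported_on E \<Longrightarrow> f \<noteq> 0 \<Longrightarrow> degree f \<le> c \<Longrightarrow> card {x. poly f x = 0} \<le> D"
    and p: "p \<in> supported_on E" "p \<noteq> 0" "degree p \<le> c + i" "\<And>x. poly p x \<ge> 0"
  shows "2 * card {x. poly p x = 0} \<le> D + i"
proof (cases "{x. poly p x = 0} = {}")
  case False
  then obtain z where z: "poly p z = 0" by auto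
  have "\<forall>\<^sub>F \<delta> in at_right 0. \<delta> > 0 \<and> (\<exists>S\<subseteq>UNIV. finite S \<and> card S = 2 * card {x. poly p x = 0} \<and>
           (\<forall>x\<in>S. poly (p + smult (-1 * \<delta>) 1) x = 0))"
    by (intro eventually_conj eventually_at_right_less
        gains_zerosD[OF zeros_double_under_lowering[OF p(2,4)]]) simp
  then obtain \<delta> S where S: "\<delta> > 0" "finite S" "card S = 2 * card {x. poly p x = 0}"
    "\<forall>x\<in>S. poly (p + smult (-1 * \<delta>) 1) x = 0"
    using eventually_happens' trivial_limit_at_right_real by blast
  define q where "q = p + smult (-1 * \<delta>) 1"
  have "poly q z \<noteq> 0" using z S(1) by (simp add: q_def)
  then have q0: "q \<noteq> 0" by auto
  have "q \<in> supported_on E" unfolding q_def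
    by (intro supported_on_add supported_on_smult p(1) supported_on_1 E(1))
  moreover have "degree q \<le> c + i" using p(3) unfolding q_def
    by (intro degree_add_le order_trans[OF degree_smult_le]) auto
  ultimately have "card {x. poly q x = 0} \<le> D + i" using number_of_zeros_le[OF E D] q0 by blast
  moreover have "card S \<le> card {x. poly q x = 0}"
    using S(4) by (intro card_mono poly_roots_finite q0) (auto simp: q_def)
  ultimately show ?thesis using S(3) by simp
qed simp

text \<open>Together with \<open>number_of_zeros_le\<close>, this gives the Descartes number of degree \<open>c + i\<close> as the
Descartes number of degree \<open>c\<close> plus \<open>i\<close>.\<close>
lemma number_of_zeros_attained:
  assumes E: "0 \<in> E" "{c..} \<subseteq> E"
    and f: "f \<in> supported_on E" "f \<noteq> 0" "degree f \<le> c" "D \<le> card {x. poly f x = 0}"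
  shows "\<exists>g \<in> supported_on E. g \<noteq> 0 \<and> degree g \<le> c + i \<and> D + i \<le> card {x. poly g x = 0}"
proof (induction i)
  case (Suc i)
  then obtain g where g: "g \<in> supported_on E" "g \<noteq> 0" "degree g \<le> c + i" "D + i \<le> card {x. poly g x = 0}"
    by blast
  have "degree g < c + Suc i" "c + Suc i \<in> E" using g(3) E(2) by auto
  from add_monomial_gains_zero[OF g(1,2) this(1) E(1) this(2)]
  obtain h where h: "h \<in> supported_on E" "degree h = c + Suc i"
    "card {x. poly g x = 0} + 1 \<le> card {x. poly h x = 0}" .
  from h(2) have "h \<noteq> 0" by (metis add_Suc_right degree_0 nat.distinct(1))
  moreover have "D + Suc i \<le> card {x. poly h x = 0}" using h(3) g(4) by simp
  ultimately show ?case using h(1,2) by (intro bexI[of _ h] conjI) simp_all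
qed (use f in auto)

section \<open>Linear functionals and interpolation\<close>

lemma supported_on_expand:
  assumes "finite F" "f \<in> supported_on F"
  shows "f = (\<Sum>i\<in>F. monom (coeff f i) i)"
proof (rule poly_eqI)
  fix j
  have "(\<Sum>i\<in>F. if i = j then coeff f i else 0) = (if j \<in> F then coeff f j else 0)"
    using assms(1) by (simp add: sum.delta)
  then show "coeff f j = coeff (\<Sum>i\<in>F. monom (coeff f i) i) j"
    using assms(2) by (auto simp: coeff_sum supported_on_def)
qed

lemma poly_supported_on:
  assumes "finite F" "f \<in> supported_on F"
  shows "poly f x = (\<Sum>i\<in>F. coeff f i * x ^ i)"
proof -
  have "poly f x = poly (\<Sum>i\<in>F. monom (coeff f i) i) x"
    using supported_on_expand[OF assms] by simp
  then show ?thesis by (simp add: poly_sum poly_monom)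
qed

context
  fixes F and L
  assumes lin: "linear_functional_on (supported_on F) L"
begin

lemma linear_functional_add: "f \<in> supported_on F \<Longrightarrow> g \<in> supported_on F \<Longrightarrow> L (f + g) = L f + L g"
  using lin by (simp add: linear_functional_on_def)

lemma linear_functional_smult: "f \<in> supported_on F \<Longrightarrow> L (smult a f) = a * L f"
  using lin by (simp add: linear_functional_on_def)

lemma linear_functional_0: "L 0 = 0"
  using linear_functional_smult[of 0 0] by simp

lemma linear_functional_diff: "f \<in> supported_on F \<Longrightarrow> g \<in> supported_on F \<Longrightarrow> L (f - g) = L f - L g"
  using linear_functional_add[of f "smult (-1) g"] linear_functional_smult[of g "-1"]
    supported_on_smult[of g F "-1"] by simp

lemma linear_functional_sum:
  "(\<And>x. x \<in> A \<Longrightarrow> f x \<in> supported_on F) \<Longrightarrow> L (sum f A) = (\<Sum>x\<in>A. L (f x))"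
  by (induction A rule: infinite_finite_induct)
    (auto simp: linear_functional_0 linear_functional_add supported_on_sum)

lemma linear_functional_expand:
  assumes "finite F" "f \<in> supported_on F"
  shows "L f = (\<Sum>i\<in>F. coeff f i * L (monom 1 i))"
proof -
  have "L f = L (\<Sum>i\<in>F. smult (coeff f i) (monom 1 i))"
    using supported_on_expand[OF assms] by (simp add: smult_monom)
  also have "\<dots> = (\<Sum>i\<in>F. L (smult (coeff f i) (monom 1 i)))"
    by (intro linear_functional_sum supported_on_smult supported_on_monom)
  also have "\<dots> = (\<Sum>i\<in>F. coeff f i * L (monom 1 i))"
    by (intro sum.cong linear_functional_smult supported_on_monom refl)
  finally show ?thesis .
qed

end

text \<open>The factor \<open>t^c\<close> moves the usual interpolation polynomials into the algebra, but it vanishes at \<open>0\<close>.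
If \<open>0\<close> is a node, its basis element is the difference between \<open>1\<close> and the sum of all the others.\<close>
lemma lagrange_basis:
  assumes E: "0 \<in> E" "{c..} \<subseteq> E" and Z: "finite Z" "card Z \<le> Suc m" and n: "c + m \<le> n"
  obtains l :: "real \<Rightarrow> real poly"
  where "\<And>z. z \<in> Z \<Longrightarrow> l z \<in> supported_on (E \<inter> {..n})"
    and "\<And>y z. y \<in> Z \<Longrightarrow> z \<in> Z \<Longrightarrow> poly (l y) z = (if y = z then 1 else 0)"
proof -
  define q where "q = (\<lambda>y. monom 1 c * (\<Prod>x\<in>Z - {y}. [:-x, 1:]))"
  define l0 where "l0 = (\<lambda>y. smult (inverse (poly (q y) y)) (q y))"
  have q: "q y \<in> supported_on (E \<inter> {..n})" if "y \<in> Z" for y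
  proof -
    have "degree (\<Prod>x\<in>Z - {y}. [:-x, 1:]) \<le> (\<Sum>x\<in>Z - {y}. 1)"
      by (rule order_trans[OF degree_prod_sum_le]) (use Z(1) in \<open>auto simp: o_def\<close>)
    also have "\<dots> \<le> m" using Z that by simp
    finally have "degree (\<Prod>x\<in>Z - {y}. [:-x, 1:]) \<le> m" .
    then show ?thesis
      using E(2) n by (auto simp: q_def supported_on_def coeff_monom_mult dest: le_degree)
  qed
  have q0: "poly (q y) z = 0" if "z \<in> Z" "z \<noteq> y" for y z
    using Z(1) that by (auto simp: q_def poly_prod)
  have qy: "poly (q y) y \<noteq> 0" if "y \<noteq> 0" for y
    using Z(1) that by (auto simp: q_def poly_prod poly_monom)
  have l0: "poly (l0 y) z = (if y = z then 1 else 0)" if "y \<in> Z" "z \<in> Z" "y \<noteq> 0" for y z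
    using q0[of z y] qy[of y] that by (auto simp: l0_def)
  have l0V: "l0 y \<in> supported_on (E \<inter> {..n})" if "y \<in> Z" for y
    using q[OF that] by (simp add: l0_def)
  \<comment> \<open>If \<open>0\<close> is a node, then \<open>l0 x\<close> vanishes there for all other nodes \<open>x\<close> by its factor \<open>[:-0, 1:]\<close>.\<close>
  define l where "l = (\<lambda>y. if y = 0 then 1 - (\<Sum>x\<in>Z - {0}. l0 x) else l0 y)"
  show thesis
  proof (rule that[of l])
    show "l z \<in> supported_on (E \<inter> {..n})" if "z \<in> Z" for z
      unfolding l_def using l0V that E(1) by (auto intro!: supported_on_diff supported_on_sum)
    have sum0: "(\<Sum>x\<in>Z - {0}. poly (l0 x) z) = (if z = 0 then 0 else 1)" if "z \<in> Z" for z
    proof -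
      have "(\<Sum>x\<in>Z - {0}. poly (l0 x) z) = (\<Sum>x\<in>Z - {0}. if x = z then 1 else 0)"
        using l0 that by (intro sum.cong) auto
      then show ?thesis using Z(1) that by (simp add: sum.delta)
    qed
    show "poly (l y) z = (if y = z then 1 else 0)" if "y \<in> Z" "z \<in> Z" for y z
      using l0[of y z] sum0[of z] that by (auto simp: l_def poly_sum)
  qed
qed

text \<open>The weights are the values of \<open>L\<close> on the interpolation basis. The difference between \<open>f\<close> and its
interpolant vanishes on \<open>Z\<close>, so that \<open>L\<close> is nonnegative on it and on its negative.\<close>
lemma conic_comb_if_nonneg:
  assumes E: "0 \<in> E" "{c..} \<subseteq> E" and Z: "finite Z" "card Z \<le> Suc m" and n: "c + m \<le> n"
    and lin: "linear_functional_on (supported_on (E \<inter> {..n})) L"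
    and nonneg: "\<And>r. r \<in> supported_on (E \<inter> {..n}) \<Longrightarrow> (\<And>z. z \<in> Z \<Longrightarrow> poly r z \<ge> 0) \<Longrightarrow> L r \<ge> 0"
  shows "conic_comb_of_evals_on (supported_on (E \<inter> {..n})) Z L"
proof -
  obtain l where l: "\<And>z. z \<in> Z \<Longrightarrow> l z \<in> supported_on (E \<inter> {..n})"
    "\<And>y z. y \<in> Z \<Longrightarrow> z \<in> Z \<Longrightarrow> poly (l y) z = (if y = z then 1 else 0)"
    using lagrange_basis[OF E Z n] by blast
  have "L f = (\<Sum>z\<in>Z. L (l z) * poly f z)" if f: "f \<in> supported_on (E \<inter> {..n})" for f
  proof -
    define s where "s = (\<Sum>z\<in>Z. smult (poly f z) (l z))"
    have s: "s \<in> supported_on (E \<inter> {..n})" unfolding s_def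
      by (intro supported_on_sum supported_on_smult l)
    have "poly s y = poly f y" if "y \<in> Z" for y
    proof -
      have "poly s y = (\<Sum>z\<in>Z. if z = y then poly f z else 0)"
        unfolding s_def using l(2) that by (auto simp: poly_sum intro!: sum.cong)
      then show ?thesis using Z(1) that by (simp add: sum.delta)
    qed
    then have "L (f - s) \<ge> 0" "L (s - f) \<ge> 0"
      by (auto intro!: nonneg supported_on_diff f s)
    then have "L f = L s"
      by (simp add: linear_functional_diff[OF lin] f s)
    also have "\<dots> = (\<Sum>z\<in>Z. L (smult (poly f z) (l z)))"
      unfolding s_def by (intro linear_functional_sum[OF lin] supported_on_smult l)
    also have "\<dots> = (\<Sum>z\<in>Z. L (l z) * poly f z)"
      by (intro sum.cong refl) (simp add: linear_functional_smult[OF lin] l)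
    finally show ?thesis .
  qed
  moreover have "L (l z) \<ge> 0" if "z \<in> Z" for z
    using l that by (intro nonneg) auto
  ultimately show ?thesis unfolding conic_comb_of_evals_on_def
    by (intro exI[of _ "\<lambda>z. L (l z)"] conjI ballI) simp_all
qed

section \<open>A minimisation problem\<close>

lemma coefficientwise_convergent_subsequence:
  fixes f :: "nat \<Rightarrow> real poly"
  assumes "finite F" "\<And>j. f j \<in> supported_on F" "\<And>j i. i \<in> F \<Longrightarrow> \<bar>coeff (f j) i\<bar> \<le> M"
  shows "\<exists>(r :: nat \<Rightarrow> nat) g. strict_mono r \<and> g \<in> supported_on F \<and>
    (\<forall>i\<in>F. (\<lambda>j. coeff (f (r j)) i) \<longlonglongrightarrow> coeff g i)"
proof -
  have "\<exists>r l. strict_mono (r :: nat \<Rightarrow> nat) \<and> (\<forall>i\<in>F. (\<lambda>j. coeff (f (r j)) i) \<longlonglongrightarrow> l i)"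
    using assms(1,3)
  proof (induction F)
    case empty
    show ?case by (intro exI[of _ id]) (auto simp: strict_mono_def)
  next
    case (insert a F)
    then obtain r l where r: "strict_mono r" and l: "\<And>i. i \<in> F \<Longrightarrow> (\<lambda>j. coeff (f (r j)) i) \<longlonglongrightarrow> l i"
      by (metis insertCI)
    have "bounded (range (\<lambda>j. coeff (f (r j)) a))"
      using insert.prems by (auto simp: bounded_iff)
    then obtain b s where s: "strict_mono s" "((\<lambda>j. coeff (f (r j)) a) \<circ> s) \<longlonglongrightarrow> b"
      using bounded_imp_convergent_subsequence by blast
    have "(\<lambda>j. coeff (f ((r \<circ> s) j)) i) \<longlonglongrightarrow> l i" if "i \<in> F" for i
      using LIMSEQ_subseq_LIMSEQ[OF l[OF that] s(1)] by (simp add: o_def)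
    then show ?case
      using s insert.hyps r by (intro exI[of _ "r \<circ> s"] exI[of _ "l(a := b)"] conjI strict_mono_o) (auto simp: o_def)
  qed
  then obtain r l where r: "strict_mono (r :: nat \<Rightarrow> nat)" and l: "\<And>i. i \<in> F \<Longrightarrow> (\<lambda>j. coeff (f (r j)) i) \<longlonglongrightarrow> l i"
    by blast
  define g where "g = (\<Sum>i\<in>F. monom (l i) i)"
  have "coeff g i = l i" if "i \<in> F" for i
    using assms(1) that by (simp add: g_def coeff_sum sum.delta)
  with r l show ?thesis by (intro exI[of _ r] exI[of _ g]) (auto simp: g_def intro!: supported_on_sum)
qed

lemma tendsto_poly_coeffs:
  assumes "finite F" "\<And>j. f j \<in> supported_on F" "g \<in> supported_on F"
    "\<And>i. i \<in> F \<Longrightarrow> (\<lambda>j. coeff (f j) i) \<longlonglongrightarrow> coeff g i"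
  shows "(\<lambda>j. poly (f j) x) \<longlonglongrightarrow> poly g x"
  unfolding poly_supported_on[OF assms(1,2)] poly_supported_on[OF assms(1,3)]
  by (intro tendsto_intros assms(4))

lemma tendsto_linear_functional_coeffs:
  assumes "finite F" "linear_functional_on (supported_on F) L" "\<And>j. f j \<in> supported_on F" "g \<in> supported_on F"
    "\<And>i. i \<in> F \<Longrightarrow> (\<lambda>j. coeff (f j) i) \<longlonglongrightarrow> coeff g i"
  shows "(\<lambda>j. L (f j)) \<longlonglongrightarrow> L g"
  unfolding linear_functional_expand[OF assms(2,1,3)] linear_functional_expand[OF assms(2,1,4)]
  by (intro tendsto_intros assms(5))

text \<open>If the sublevel set were unbounded, then a sequence in it with norms tending to infinity, scaled to norm
\<open>1\<close>, would have a limit point \<open>g\<close> of norm \<open>1\<close>. The function \<open>b\<close> disappears in the limit, so \<open>g\<close> would be nonnegative with \<open>L g \<le> 0\<close>, against \<open>pos\<close>.\<close>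
lemma sublevel_bounded:
  fixes b :: "real \<Rightarrow> real"
  assumes fin: "finite F" and lin: "linear_functional_on (supported_on F) L"
    and pos: "\<And>f. f \<in> supported_on F \<Longrightarrow> f \<noteq> 0 \<Longrightarrow> (\<And>x. poly f x \<ge> 0) \<Longrightarrow> L f > 0"
  shows "\<exists>M. \<forall>f\<in>supported_on F. (\<forall>x. b x + poly f x \<ge> 0) \<longrightarrow> L f \<le> 0 \<longrightarrow> (\<forall>i\<in>F. \<bar>coeff f i\<bar> \<le> M)"
proof (rule ccontr)
  define N where "N = (\<lambda>f :: real poly. \<Sum>i\<in>F. \<bar>coeff f i\<bar>)"
  have coeff_le: "\<bar>coeff f i\<bar> \<le> N f" if "i \<in> F" for f i
    using member_le_sum[OF that, of "\<lambda>i. \<bar>coeff f i\<bar>"] fin by (simp add: N_def)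
  assume "\<not> ?thesis"
  then have "\<forall>j::nat. \<exists>f. f \<in> supported_on F \<and> (\<forall>x. b x + poly f x \<ge> 0) \<and> L f \<le> 0 \<and> N f > Suc j"
    by (meson coeff_le not_le order_trans)
  then obtain f where f: "\<And>j::nat. f j \<in> supported_on F" "\<And>j x. b x + poly (f j) x \<ge> 0"
      "\<And>j. L (f j) \<le> 0" "\<And>j. N (f j) > Suc j"
    by metis
  define h where "h = (\<lambda>j. smult (inverse (N (f j))) (f j))"
  have N0: "N (f j) > 0" for j using f(4)[of j] by linarith
  have h: "h j \<in> supported_on F" for j using f(1) by (simp add: h_def)
  have hc: "\<bar>coeff (h j) i\<bar> \<le> 1" if "i \<in> F" for i j
    using coeff_le[OF that, of "f j"] N0[of j] by (simp add: h_def abs_mult field_simps)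
  have "N (smult a p) = \<bar>a\<bar> * N p" for a p
    by (simp add: N_def abs_mult sum_distrib_left)
  then have Nh: "N (h j) = 1" for j
    using N0[of j] by (simp add: h_def)
  from coefficientwise_convergent_subsequence[of F h, OF fin h hc]
  obtain r g where r: "strict_mono r" and g: "g \<in> supported_on F"
    and "\<forall>i\<in>F. (\<lambda>j. coeff (h (r j)) i) \<longlonglongrightarrow> coeff g i"
    by blast
  note conv = bspec[OF this(3)]
  have "(\<lambda>j. N (h (r j))) \<longlonglongrightarrow> N g" unfolding N_def by (intro tendsto_intros conv)
  then have "N g = 1" unfolding Nh by (simp add: LIMSEQ_const_iff)
  then have g0: "g \<noteq> 0" by (auto simp: N_def)
  have "poly g x \<ge> 0" for x
  proof -
    have "(\<lambda>j. poly (h (r j)) x) \<longlonglongrightarrow> poly g x"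
      by (rule tendsto_poly_coeffs[OF fin h g conv])
    moreover have "(\<lambda>j. - \<bar>b x\<bar> * inverse (real (Suc (r j)))) \<longlonglongrightarrow> - \<bar>b x\<bar> * 0"
      using LIMSEQ_subseq_LIMSEQ[OF LIMSEQ_inverse_real_of_nat r] by (intro tendsto_intros) (simp add: o_def)
    moreover have "- \<bar>b x\<bar> * inverse (real (Suc (r j))) \<le> poly (h (r j)) x" for j
    proof -
      have "inverse (N (f (r j))) \<le> inverse (real (Suc (r j)))"
        using f(4)[of "r j"] by (intro le_imp_inverse_le) auto
      then have "- \<bar>b x\<bar> * inverse (real (Suc (r j))) \<le> - \<bar>b x\<bar> * inverse (N (f (r j)))"
        by (intro mult_left_mono_neg) auto
      also have "\<dots> = inverse (N (f (r j))) * - \<bar>b x\<bar>" by (rule mult.commute)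
      also have "\<dots> \<le> inverse (N (f (r j))) * poly (f (r j)) x"
      proof (rule mult_left_mono)
        show "- \<bar>b x\<bar> \<le> poly (f (r j)) x" using f(2)[of x "r j"] by linarith
        show "0 \<le> inverse (N (f (r j)))" using N0[of "r j"] by simp
      qed
      finally show ?thesis by (simp add: h_def)
    qed
    then have "\<exists>k. \<forall>j\<ge>k. - \<bar>b x\<bar> * inverse (real (Suc (r j))) \<le> poly (h (r j)) x" by blast
    ultimately have "- \<bar>b x\<bar> * 0 \<le> poly g x" by (meson LIMSEQ_le)
    then show ?thesis by simp
  qed
  with pos g g0 have "L g > 0" by blast
  moreover have "(\<lambda>j. L (h (r j))) \<longlonglongrightarrow> L g"
    by (rule tendsto_linear_functional_coeffs[OF fin lin h g conv])
  moreover have "L (h j) \<le> 0" for j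
    using f(3)[of j] N0[of j] by (simp add: h_def linear_functional_smult[OF lin f(1)] mult_le_0_iff)
  then have "\<exists>k. \<forall>j\<ge>k. L (h (r j)) \<le> 0" by blast
  ultimately show False using LIMSEQ_le_const2 linorder_not_less by blast
qed

text \<open>The zero polynomial is admissible, so it suffices to minimise over the sublevel set \<open>L f \<le> 0\<close>,
which is compact.\<close>
lemma minimiser_exists:
  fixes b :: "real \<Rightarrow> real"
  assumes fin: "finite F" and lin: "linear_functional_on (supported_on F) L"
    and pos: "\<And>f. f \<in> supported_on F \<Longrightarrow> f \<noteq> 0 \<Longrightarrow> (\<And>x. poly f x \<ge> 0) \<Longrightarrow> L f > 0"
    and b: "\<And>x. b x \<ge> 0"
  shows "\<exists>f\<in>supported_on F. (\<forall>x. b x + poly f x \<ge> 0) \<and>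
    (\<forall>g\<in>supported_on F. (\<forall>x. b x + poly g x \<ge> 0) \<longrightarrow> L f \<le> L g)"
proof -
  obtain M where M: "\<And>f i. f \<in> supported_on F \<Longrightarrow> (\<And>x. b x + poly f x \<ge> 0) \<Longrightarrow> L f \<le> 0 \<Longrightarrow> i \<in> F \<Longrightarrow> \<bar>coeff f i\<bar> \<le> M"
    using sublevel_bounded[OF fin lin pos, of b] by blast
  define A where "A = {f \<in> supported_on F. (\<forall>x. b x + poly f x \<ge> 0) \<and> L f \<le> 0}"
  have A0: "0 \<in> A" using b by (simp add: A_def linear_functional_0[OF lin])
  have coeffA: "\<bar>coeff f i\<bar> \<le> M" if "f \<in> A" "i \<in> F" for f i
    using M[of f i] that by (auto simp: A_def)
  have bdd: "bdd_below (L ` A)"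
  proof (rule bdd_belowI2)
    fix f assume f: "f \<in> A"
    then have "L f = (\<Sum>i\<in>F. coeff f i * L (monom 1 i))"
      by (intro linear_functional_expand[OF lin fin]) (simp add: A_def)
    moreover have "- (M * \<bar>L (monom 1 i)\<bar>) \<le> coeff f i * L (monom 1 i)" if "i \<in> F" for i
    proof -
      have "\<bar>coeff f i * L (monom 1 i)\<bar> \<le> M * \<bar>L (monom 1 i)\<bar>"
        unfolding abs_mult using coeffA[OF f that] by (intro mult_right_mono) auto
      then show ?thesis by linarith
    qed
    ultimately show "(\<Sum>i\<in>F. - (M * \<bar>L (monom 1 i)\<bar>)) \<le> L f" by (simp only: sum_mono)
  qed
  define m where "m = Inf (L ` A)"
  have "\<exists>f\<in>A. L f < m + inverse (real (Suc j))" for j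
    using cInf_less_iff[of "L ` A" "m + inverse (real (Suc j))"] bdd A0 by (auto simp: m_def)
  then have "\<forall>j. \<exists>f. f \<in> A \<and> L f < m + inverse (real (Suc j))" by blast
  from choice[OF this] obtain f where f: "\<And>j. f j \<in> A" "\<And>j. L (f j) < m + inverse (real (Suc j))"
    by blast
  have fF: "f j \<in> supported_on F" for j using f(1) by (simp add: A_def)
  from coefficientwise_convergent_subsequence[of F f, OF fin fF coeffA[OF f(1)]]
  obtain r g where r: "strict_mono r" and g: "g \<in> supported_on F"
    and "\<forall>i\<in>F. (\<lambda>j. coeff (f (r j)) i) \<longlonglongrightarrow> coeff g i"
    by blast
  note conv = bspec[OF this(3)]
  have g_nonneg: "b x + poly g x \<ge> 0" for x
  proof -
    have "(\<lambda>j. b x + poly (f (r j)) x) \<longlonglongrightarrow> b x + poly g x"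
      by (intro tendsto_intros tendsto_poly_coeffs[OF fin fF g conv])
    then show ?thesis by (rule LIMSEQ_le_const) (use f(1) in \<open>auto simp: A_def\<close>)
  qed
  have "(\<lambda>j. L (f (r j))) \<longlonglongrightarrow> L g"
    by (rule tendsto_linear_functional_coeffs[OF fin lin fF g conv])
  moreover have "(\<lambda>j. m + inverse (real (Suc (r j)))) \<longlonglongrightarrow> m + 0"
    using LIMSEQ_subseq_LIMSEQ[OF LIMSEQ_inverse_real_of_nat r] by (intro tendsto_intros) (simp add: o_def)
  ultimately have "L g \<le> m + 0"
    by (rule LIMSEQ_le) (use f(2) order_less_imp_le in blast)
  then have Lg: "L g \<le> m" by simp
  have m0: "m \<le> 0" using cInf_lower[OF imageI[OF A0] bdd] by (simp add: m_def linear_functional_0[OF lin])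
  show ?thesis
  proof (intro bexI[OF _ g] conjI allI ballI impI g_nonneg)
    fix h assume h: "h \<in> supported_on F" "\<forall>x. b x + poly h x \<ge> 0"
    show "L g \<le> L h"
    proof (cases "L h \<le> 0")
      case True
      with h have "h \<in> A" by (simp add: A_def)
      then have "m \<le> L h" unfolding m_def using bdd by (intro cInf_lower) auto
      with Lg show ?thesis by simp
    qed (use Lg m0 in simp)
  qed
qed

section \<open>Perturbing a nonnegative polynomial\<close>

lemma poly_dominated_at_infinity:
  fixes q :: "real poly"
  assumes "degree q < n"
  obtains M where "\<And>x. M \<le> \<bar>x\<bar> \<Longrightarrow> \<bar>poly q x\<bar> \<le> \<bar>x\<bar> ^ n / 2"
proof -
  obtain n' where n: "n = Suc n'" using assms by (cases n) auto
  define B where "B = (\<Sum>i<n. \<bar>coeff q i\<bar>)"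
  have q: "q \<in> supported_on {..<n}" using assms le_degree by (fastforce simp: supported_on_def)
  show thesis
  proof (rule that)
    fix x :: real assume x: "max 1 (2 * B) \<le> \<bar>x\<bar>"
    have "\<bar>poly q x\<bar> \<le> (\<Sum>i<n. \<bar>coeff q i * x ^ i\<bar>)"
      unfolding poly_supported_on[OF finite_lessThan q] by (rule sum_abs)
    also have "\<dots> \<le> (\<Sum>i<n. \<bar>coeff q i\<bar> * \<bar>x\<bar> ^ n')"
      using x by (intro sum_mono) (auto simp: n abs_mult power_abs intro!: mult_left_mono power_increasing)
    also have "\<dots> = B * \<bar>x\<bar> ^ n'" by (simp add: B_def sum_distrib_right)
    also have "\<dots> \<le> (\<bar>x\<bar> / 2) * \<bar>x\<bar> ^ n'" using x by (intro mult_right_mono) auto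
    finally show "\<bar>poly q x\<bar> \<le> \<bar>x\<bar> ^ n / 2" by (simp add: n)
  qed
qed

text \<open>Where \<open>r\<close> is positive there is nothing to show. Far out, the leading term dominates. The remaining
points form a compact set on which \<open>x^n + f\<close> has no zero and thus a positive minimum.\<close>
lemma nonneg_perturbation:
  fixes f r :: "real poly"
  assumes n: "even n" and deg: "degree f < n" "degree r < n"
    and nonneg: "\<And>x. 0 \<le> x ^ n + poly f x"
    and pos: "\<And>x. x ^ n + poly f x = 0 \<Longrightarrow> poly r x > 0"
  obtains \<epsilon> where "\<epsilon> > 0" "\<And>x. 0 \<le> x ^ n + poly (f + smult \<epsilon> r) x"
proof -
  obtain M1 where M1: "\<And>x. M1 \<le> \<bar>x\<bar> \<Longrightarrow> \<bar>poly f x\<bar> \<le> \<bar>x\<bar> ^ n / 2"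
    using poly_dominated_at_infinity[OF deg(1)] by blast
  obtain M2 where M2: "\<And>x. M2 \<le> \<bar>x\<bar> \<Longrightarrow> \<bar>poly r x\<bar> \<le> \<bar>x\<bar> ^ n / 2"
    using poly_dominated_at_infinity[OF deg(2)] by blast
  define M where "M = max M1 M2"
  have outside: "0 \<le> x ^ n + poly f x + \<epsilon> * poly r x" if "M \<le> \<bar>x\<bar>" "0 < \<epsilon>" "\<epsilon> \<le> 1" for x \<epsilon>
  proof -
    have "\<bar>\<epsilon> * poly r x\<bar> \<le> \<bar>poly r x\<bar>"
      using that(2,3) by (simp add: abs_mult mult_left_le_one_le)
    moreover have "\<bar>x\<bar> ^ n = x ^ n" using n by (simp add: power_even_abs)
    ultimately show ?thesis using M1[of x] M2[of x] that(1) by (simp add: M_def)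
  qed
  define K where "K = {-M..M} \<inter> {x. poly r x \<le> 0}"
  have "closed {x. poly r x \<le> 0}" by (intro closed_Collect_le continuous_intros)
  then have K: "compact K" unfolding K_def by (intro compact_Int_closed compact_Icc)
  have "\<exists>\<epsilon>. 0 < \<epsilon> \<and> \<epsilon> \<le> 1 \<and> (\<forall>x\<in>K. 0 \<le> x ^ n + poly f x + \<epsilon> * poly r x)"
  proof (cases "K = {}")
    case False
    have "continuous_on K (\<lambda>x. x ^ n + poly f x)" by (intro continuous_intros)
    from continuous_attains_inf[OF K False this]
    obtain a where a: "a \<in> K" "\<And>x. x \<in> K \<Longrightarrow> a ^ n + poly f a \<le> x ^ n + poly f x" by blast
    have "continuous_on K (poly r)" by (intro continuous_intros)
    from continuous_attains_inf[OF K False this]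
    obtain b where b: "b \<in> K" "\<And>x. x \<in> K \<Longrightarrow> poly r b \<le> poly r x" by blast
    define m where "m = a ^ n + poly f a"
    define B where "B = - poly r b"
    have m: "m > 0" using nonneg[of a] pos[of a] a(1) by (force simp: m_def K_def)
    have B: "B \<ge> 0" using b(1) by (simp add: B_def K_def)
    define \<epsilon> where "\<epsilon> = min 1 (m / (B + 1))"
    have eps: "0 < \<epsilon>" "\<epsilon> \<le> 1" using m B by (auto simp: \<epsilon>_def)
    have "\<epsilon> \<le> m / (B + 1)" by (simp add: \<epsilon>_def)
    then have "\<epsilon> * (B + 1) \<le> m" using B by (simp add: pos_le_divide_eq)
    then have eB: "\<epsilon> * B \<le> m" using eps by (simp add: algebra_simps)
    have "0 \<le> x ^ n + poly f x + \<epsilon> * poly r x" if "x \<in> K" for x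
    proof -
      have "\<epsilon> * (- B) \<le> \<epsilon> * poly r x" using b(2)[OF that] eps by (intro mult_left_mono) (auto simp: B_def)
      moreover have "m \<le> x ^ n + poly f x" using a(2)[OF that] by (simp add: m_def)
      ultimately show ?thesis using eB by simp
    qed
    with eps show ?thesis by blast
  qed (use zero_less_one in blast)
  then obtain \<epsilon> where eps: "0 < \<epsilon>" "\<epsilon> \<le> 1" and inside: "\<And>x. x \<in> K \<Longrightarrow> 0 \<le> x ^ n + poly f x + \<epsilon> * poly r x"
    by blast
  show thesis
  proof (rule that[OF eps(1)])
    fix x
    consider "M \<le> \<bar>x\<bar>" | "x \<in> K" | "poly r x > 0" by (force simp: K_def)
    then have "0 \<le> x ^ n + poly f x + \<epsilon> * poly r x"
    proof cases
      case 3
      then show ?thesis using nonneg[of x] eps by simp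
    qed (use outside[OF _ eps] inside in auto)
    then show "0 \<le> x ^ n + poly (f + smult \<epsilon> r) x" by (simp add: add.assoc)
  qed
qed

section \<open>Representing measures with few atoms\<close>

text \<open>A nonnegative \<open>g\<close> with integral \<open>0\<close> vanishes almost everywhere, so the measure lives on the zeros of \<open>g\<close>.\<close>
lemma moment_functional_nonneg_on_zero_set:
  assumes L: "moment_functional_on V L" and g: "g \<in> V" "\<And>x. poly g x \<ge> 0" "L g = 0"
    and r: "r \<in> V" "\<And>x. poly g x = 0 \<Longrightarrow> poly r x \<ge> 0"
  shows "L r \<ge> 0"
proof -
  obtain \<mu> :: "real measure" where \<mu>: "\<And>f. f \<in> V \<Longrightarrow> integrable \<mu> (poly f)"
    "\<And>f. f \<in> V \<Longrightarrow> L f = (\<integral>x. poly f x \<partial>\<mu>)"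
    using L unfolding moment_functional_on_def by blast
  have "AE x in \<mu>. poly g x = 0"
    using integral_nonneg_eq_0_iff_AE[OF \<mu>(1)[OF g(1)]] g \<mu>(2)[OF g(1)] by simp
  then have "AE x in \<mu>. 0 \<le> poly r x" by (rule eventually_mono) (rule r(2))
  then show ?thesis unfolding \<mu>(2)[OF r(1)] by (rule integral_nonneg_AE)
qed

lemma moment_functional_nonneg:
  assumes "moment_functional_on V L" "f \<in> V" "\<And>x. poly f x \<ge> 0"
  shows "L f \<ge> 0"
  using assms unfolding moment_functional_on_def by (metis Bochner_Integration.integral_nonneg)

text \<open>Otherwise \<open>f\<close> could be improved by adding a small multiple of \<open>r\<close>. Before that, \<open>r\<close> is raised by a small
constant, to be strictly positive on the contact set.\<close>
lemma minimiser_nonneg_on_contact_set: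
  assumes F: "0 \<in> F" "F \<subseteq> {..<n}" and n: "even n"
    and lin: "linear_functional_on (supported_on F) L" and L1: "L 1 \<ge> 0"
    and f: "f \<in> supported_on F" "\<And>x. x ^ n + poly f x \<ge> 0"
    and min: "\<And>g. g \<in> supported_on F \<Longrightarrow> (\<And>x. x ^ n + poly g x \<ge> 0) \<Longrightarrow> L f \<le> L g"
    and r: "r \<in> supported_on F" "\<And>x. x ^ n + poly f x = 0 \<Longrightarrow> poly r x \<ge> 0"
  shows "L r \<ge> 0"
proof (rule ccontr)
  assume "\<not> L r \<ge> 0"
  then have neg: "L r < 0" by simp
  define \<delta> where "\<delta> = - L r / (2 * (L 1 + 1))"
  define r' where "r' = r + smult \<delta> 1"
  have \<delta>: "\<delta> > 0" unfolding \<delta>_def using neg L1 by (intro divide_pos_pos) auto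
  have one: "1 \<in> supported_on F" using F(1) by simp
  have r': "r' \<in> supported_on F" unfolding r'_def by (intro supported_on_add supported_on_smult r(1) one)
  have "L r' = L r + \<delta> * L 1"
    unfolding r'_def by (simp only: linear_functional_add[OF lin r(1) supported_on_smult[OF one]]
        linear_functional_smult[OF lin one])
  also have "\<delta> * L 1 \<le> \<delta> * (L 1 + 1)" using \<delta> by simp
  also have "\<delta> * (L 1 + 1) = - L r / 2" using L1 by (simp add: \<delta>_def field_simps)
  finally have Lr': "L r' < 0" using neg by simp
  have deg: "degree h < n" if "h \<in> supported_on F" for h
  proof -
    have "0 < n" using F by auto
    moreover have "coeff h i = 0" if "i \<ge> n" for i
      using \<open>h \<in> supported_on F\<close> F(2) that by (fastforce simp: supported_on_def)
    ultimately show ?thesis by (metis degree_0 leading_coeff_0_iff not_le)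
  qed
  have "poly r' x > 0" if "x ^ n + poly f x = 0" for x
    using r(2)[OF that] \<delta> by (simp add: r'_def)
  then obtain \<epsilon> where eps: "\<epsilon> > 0" "\<And>x. 0 \<le> x ^ n + poly (f + smult \<epsilon> r') x"
    using nonneg_perturbation[OF n deg[OF f(1)] deg[OF r'] f(2)] by blast
  have "L f \<le> L (f + smult \<epsilon> r')"
    by (intro min eps(2) supported_on_add supported_on_smult f(1) r')
  also have "\<dots> = L f + \<epsilon> * L r'"
    by (simp only: linear_functional_add[OF lin f(1) supported_on_smult[OF r']] linear_functional_smult[OF lin r'])
  finally have "0 \<le> \<epsilon> * L r'" by simp
  with eps(1) Lr' show False by (simp add: zero_le_mult_iff)
qed

text \<open>The atoms are the zeros of a suitable nonnegative polynomial \<open>p\<close> of the algebra. If \<open>L\<close> vanishes on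
some nonzero nonnegative polynomial, this one is used. Otherwise \<open>L\<close> is strictly positive, and \<open>p = t^(2k+2) + f\<close> with \<open>L f\<close>
minimal. Working in degree \<open>2k+2\<close> instead of \<open>2k\<close> costs one atom,
but it excludes an atom at infinity, because \<open>p\<close> does not vanish there.\<close>
lemma moment_functional_few_atoms:
  assumes E: "0 \<in> E" "{c..} \<subseteq> E" and "c \<le> k" "D \<le> c"
    and D: "\<And>f. f \<in> supported_on E \<Longrightarrow> f \<noteq> 0 \<Longrightarrow> degree f \<le> c \<Longrightarrow> card {x. poly f x = 0} \<le> D"
    and L: "moment_functional_on (supported_on (E \<inter> {..2*k})) L"
  obtains Z where "finite Z" "2 * card Z + c \<le> D + 2 * k + 2"
    "conic_comb_of_evals_on (supported_on (E \<inter> {..2*k})) Z L"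
proof -
  let ?V = "supported_on (E \<inter> {..2*k})"
  have lin: "linear_functional_on ?V L" using L by (simp add: moment_functional_on_def)
  have VE: "f \<in> supported_on E" if "f \<in> ?V" for f
    using that supported_on_mono[of "E \<inter> {..2*k}" E] by auto
  have *: "2 * card {x. poly p x = 0} + c \<le> D + 2 * k + 2 \<and> conic_comb_of_evals_on ?V {x. poly p x = 0} L"
    if p: "p \<in> supported_on E" "p \<noteq> 0" "degree p \<le> 2 * k + 2" "\<And>x. poly p x \<ge> 0"
      and nonneg: "\<And>r. r \<in> ?V \<Longrightarrow> (\<And>x. poly p x = 0 \<Longrightarrow> poly r x \<ge> 0) \<Longrightarrow> L r \<ge> 0" for p
  proof -
    have "degree p \<le> c + (2 * k + 2 - c)" using p(3) \<open>c \<le> k\<close> by simp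
    from number_of_zeros_nonneg_le[OF E D p(1,2) this p(4)]
    have card: "2 * card {x. poly p x = 0} + c \<le> D + 2 * k + 2" using \<open>c \<le> k\<close> by simp
    then have card': "card {x. poly p x = 0} \<le> Suc k" using \<open>D \<le> c\<close> by simp
    have "conic_comb_of_evals_on ?V {x. poly p x = 0} L"
      by (rule conic_comb_if_nonneg[OF E poly_roots_finite[OF p(2)] card' _ lin])
        (use \<open>c \<le> k\<close> nonneg in auto)
    with card show ?thesis by blast
  qed
  show thesis
  proof (cases "\<exists>g\<in>?V. g \<noteq> 0 \<and> (\<forall>x. poly g x \<ge> 0) \<and> L g = 0")
    case True
    then obtain g where g: "g \<in> ?V" "g \<noteq> 0" "\<And>x. poly g x \<ge> 0" "L g = 0" by blast
    have "degree g \<le> 2 * k + 2" using degree_supported_on[OF g(1)] by simp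
    from *[OF VE[OF g(1)] g(2) this g(3) moment_functional_nonneg_on_zero_set[OF L g(1,3,4)]]
    show thesis using that[OF poly_roots_finite[OF g(2)]] by blast
  next
    case False
    have pos: "L f > 0" if "f \<in> ?V" "f \<noteq> 0" "\<And>x. poly f x \<ge> 0" for f
      using moment_functional_nonneg[OF L that(1,3)] False that by force
    let ?n = "2 * k + 2"
    have "\<exists>f\<in>?V. (\<forall>x. x ^ ?n + poly f x \<ge> 0) \<and>
        (\<forall>g\<in>?V. (\<forall>x. x ^ ?n + poly g x \<ge> 0) \<longrightarrow> L f \<le> L g)"
    proof (rule minimiser_exists[OF _ lin pos])
      show "0 \<le> x ^ ?n" for x :: real by (rule zero_le_even_power) simp
    qed simp
    then obtain f where f: "f \<in> ?V" "\<And>x. x ^ ?n + poly f x \<ge> 0"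
      and min: "\<And>g. g \<in> ?V \<Longrightarrow> (\<And>x. x ^ ?n + poly g x \<ge> 0) \<Longrightarrow> L f \<le> L g"
      by blast
    define p where "p = monom 1 ?n + f"
    have poly_p: "poly p x = x ^ ?n + poly f x" for x by (simp add: p_def poly_monom)
    have degf: "degree f \<le> 2 * k" using f(1) by (rule degree_supported_on)
    have "coeff p ?n = 1" using degf by (simp add: p_def coeff_eq_0)
    then have p0: "p \<noteq> 0" by auto
    have nE: "?n \<in> E" using E(2) \<open>c \<le> k\<close> by auto
    have pE: "p \<in> supported_on E" unfolding p_def by (intro supported_on_add supported_on_monom nE VE f(1))
    have degp: "degree p \<le> ?n" unfolding p_def using degf by (intro degree_add_le degree_monom_le) simp
    have pnn: "poly p x \<ge> 0" for x using f(2) by (simp add: poly_p)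
    have L1: "L 1 \<ge> 0" using E(1) by (intro moment_functional_nonneg[OF L]) auto
    have "L r \<ge> 0" if r: "r \<in> ?V" "\<And>x. poly p x = 0 \<Longrightarrow> poly r x \<ge> 0" for r
    proof (rule minimiser_nonneg_on_contact_set[OF _ _ _ lin L1 f min r(1)])
      show "0 \<in> E \<inter> {..2*k}" using E(1) by simp
      show "E \<inter> {..2*k} \<subseteq> {..<?n}" by auto
      show "poly r x \<ge> 0" if "x ^ ?n + poly f x = 0" for x
        using r(2)[of x] that by (simp only: poly_p)
    qed simp
    from *[OF pE p0 degp pnn this] show thesis using that[OF poly_roots_finite[OF p0]] by blast
  qed
qed

section \<open>Functionals that need many atoms\<close>

lemma moment_functional_sum_of_evals:
  assumes "finite Z"
  shows "moment_functional_on V (\<lambda>f. \<Sum>z\<in>Z. poly f z)"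
proof -
  define \<mu> :: "real measure" where "\<mu> = distr (count_space Z) borel id"
  have [measurable]: "id \<in> measurable (count_space Z) borel" by simp
  have poly_meas: "poly f \<in> borel_measurable borel" for f :: "real poly"
    by (intro borel_measurable_continuous_onI continuous_intros)
  have "integrable \<mu> (poly f)" for f
    unfolding \<mu>_def using assms poly_meas by (subst integrable_distr_eq) (auto intro: integrable_count_space)
  moreover have "(\<integral>x. poly f x \<partial>\<mu>) = (\<Sum>z\<in>Z. poly f z)" for f
    unfolding \<mu>_def using assms poly_meas
    by (subst integral_distr) (auto simp: lebesgue_integral_count_space_finite)
  moreover have "sets \<mu> = sets borel" by (simp add: \<mu>_def)
  moreover have "linear_functional_on V (\<lambda>f. \<Sum>z\<in>Z. poly f z)"
    by (simp add: linear_functional_on_def sum.distrib sum_distrib_left)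
  ultimately show ?thesis unfolding moment_functional_on_def by metis
qed

text \<open>The functional vanishes on \<open>f * f\<close>, so every atom with positive weight is a zero of \<open>f\<close>. The
interpolation basis then shows that each zero has weight \<open>1\<close>.\<close>
lemma zeros_subset_of_atoms:
  assumes E: "0 \<in> E" "{c..} \<subseteq> E" "\<And>i j. i \<in> E \<Longrightarrow> j \<in> E \<Longrightarrow> i + j \<in> E" and "c \<le> k"
    and f: "f \<in> supported_on E" "f \<noteq> 0" "degree f \<le> k"
    and S: "finite S" "conic_comb_of_evals_on (supported_on (E \<inter> {..2*k})) S (\<lambda>g. \<Sum>z | poly f z = 0. poly g z)"
  shows "{z. poly f z = 0} \<subseteq> S"
proof
  let ?V = "supported_on (E \<inter> {..2*k})" and ?Z = "{z. poly f z = 0}"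
  obtain w where w: "\<And>x. x \<in> S \<Longrightarrow> w x \<ge> 0"
    "\<And>g. g \<in> ?V \<Longrightarrow> (\<Sum>z\<in>?Z. poly g z) = (\<Sum>x\<in>S. w x * poly g x)"
    using S(2) unfolding conic_comb_of_evals_on_def by blast
  have "f * f \<in> supported_on E"
    unfolding supported_on_def
  proof (intro CollectI allI impI)
    fix i assume "coeff (f * f) i \<noteq> 0"
    then obtain j where "j \<le> i" "coeff f j * coeff f (i - j) \<noteq> 0"
      unfolding coeff_mult by (meson atMost_iff sum.not_neutral_contains_not_neutral)
    then have "j \<in> E" "i - j \<in> E" "i = j + (i - j)" using f(1) by (auto simp: supported_on_def)
    then show "i \<in> E" using E(3) by metis
  qed
  moreover have "degree (f * f) \<le> 2 * k" using f(3) degree_mult_le[of f f] by simp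
  ultimately have ffV: "f * f \<in> ?V" using le_degree by (fastforce simp: supported_on_def)
  have "(\<Sum>x\<in>S. w x * poly (f * f) x) = 0" using w(2)[OF ffV] by simp
  then have "\<forall>x\<in>S. w x * poly (f * f) x = 0"
    using w(1) S(1) by (subst (asm) sum_nonneg_eq_0_iff) auto
  then have w0: "w x = 0" if "x \<in> S" "x \<notin> ?Z" for x using that by auto
  have card: "card ?Z \<le> Suc k" using card_poly_roots_bound[OF f(2)] f(3) by simp
  have deg: "c + k \<le> 2 * k" using \<open>c \<le> k\<close> by simp
  obtain l where l: "\<And>z. z \<in> ?Z \<Longrightarrow> l z \<in> ?V"
    "\<And>y z. y \<in> ?Z \<Longrightarrow> z \<in> ?Z \<Longrightarrow> poly (l y) z = (if y = z then 1 else 0)"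
    using lagrange_basis[OF E(1,2) poly_roots_finite[OF f(2)] card deg] by blast
  fix z assume z: "z \<in> ?Z"
  have "(\<Sum>y\<in>?Z. poly (l z) y) = (\<Sum>y\<in>?Z. if z = y then 1 else 0)"
    using l(2) z by (intro sum.cong) auto
  also have "\<dots> = 1" using z poly_roots_finite[OF f(2)] by (simp add: sum.delta)
  finally have one: "(\<Sum>x\<in>S. w x * poly (l z) x) = 1" using w(2)[OF l(1)[OF z]] by simp
  show "z \<in> S"
  proof (rule ccontr)
    assume "z \<notin> S"
    have "w x * poly (l z) x = 0" if "x \<in> S" for x
    proof (cases "x \<in> ?Z")
      case True
      moreover have "z \<noteq> x" using that \<open>z \<notin> S\<close> by auto
      ultimately show ?thesis using l(2)[OF z True] by simp
    qed (use w0 that in auto)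
    then have "(\<Sum>x\<in>S. w x * poly (l z) x) = 0" by (intro sum.neutral ballI)
    with one show False by simp
  qed
qed

section \<open>Monomial algebras\<close>

text \<open>The least positive difference \<open>g\<close> of two elements of \<open>E\<close> divides all elements of \<open>E\<close>, as remainders modulo
\<open>g\<close> are again such differences. Hence \<open>g = 1\<close>, and \<open>E\<close> contains two consecutive numbers \<open>x\<close> and \<open>x + 1\<close>, and every \<open>n \<ge> x^2\<close> is a sum of these.\<close>
lemma cofinite_if_Gcd_1:
  assumes E: "0 \<in> E" "\<And>i j. i \<in> E \<Longrightarrow> j \<in> E \<Longrightarrow> i + j \<in> E" and A: "A \<subseteq> E" "Gcd A = (1::nat)"
  obtains c where "{c..} \<subseteq> E"
proof -
  have mult: "q * e \<in> E" if "e \<in> E" for q e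
    by (induction q) (use E that in auto)
  define P where "P = (\<lambda>g. g > 0 \<and> (\<exists>x\<in>E. x + g \<in> E))"
  have "\<not> A \<subseteq> {0}" using A(2) by (metis Gcd_0_iff zero_neq_one)
  then have "\<exists>g. P g" using A(1) E(1) by (force simp: P_def)
  define g where "g = (LEAST g. P g)"
  have "P g" unfolding g_def by (rule LeastI_ex) fact
  then obtain x where x: "g > 0" "x \<in> E" "x + g \<in> E" by (auto simp: P_def)
  have "g dvd e" if "e \<in> E" for e
  proof (rule ccontr)
    assume "\<not> g dvd e"
    then have h: "e mod g > 0" by (simp add: dvd_eq_mod_eq_0)
    have "(e div g) * (x + g) + e mod g = e + (e div g) * x"
      by (simp add: algebra_simps)
    then have "P (e mod g)"
      unfolding P_def using h mult[OF x(3), of "e div g"] E(2)[OF that mult[OF x(2), of "e div g"]]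
      by (intro conjI bexI[of _ "(e div g) * (x + g)"]) auto
    then have "g \<le> e mod g" unfolding g_def by (rule Least_le)
    with mod_less_divisor[OF x(1), of e] show False by linarith
  qed
  then have "g dvd Gcd A" using A(1) by (intro Gcd_greatest) auto
  then have "g = 1" using A(2) by simp
  with x have x1: "x + 1 \<in> E" by simp
  have "n \<in> E" if "n \<ge> x * x" for n
  proof (cases "x = 0")
    case True
    then show ?thesis using mult[OF x1, of n] by simp
  next
    case False
    define q r where "q = n div x" and "r = n mod x"
    have "r < x" using False by (simp add: r_def)
    moreover have "x \<le> q" using that False by (simp add: q_def less_eq_div_iff_mult_less_eq)
    ultimately have rq: "r \<le> q" by simp
    have "n = q * x + r" by (simp add: q_def r_def)
    also have "\<dots> = (q - r) * x + r * (x + 1)" using rq by (simp add: algebra_simps diff_mult_distrib)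
    finally have "n = (q - r) * x + r * (x + 1)" .
    then show ?thesis using E(2) mult x(2) x1 by metis
  qed
  then show thesis using that[of "x * x"] by auto
qed

lemma monom_mem_monomial_algebra: "d \<in> set ds \<Longrightarrow> monom 1 d \<in> monomial_algebra ds"
  unfolding monomial_algebra_def by (intro real_subalgebra.gen) auto

lemma monom_add_mem_monomial_algebra:
  "monom 1 i \<in> monomial_algebra ds \<Longrightarrow> monom 1 j \<in> monomial_algebra ds \<Longrightarrow> monom 1 (i + j) \<in> monomial_algebra ds"
  unfolding monomial_algebra_def using real_subalgebra.mult[of "monom 1 i" _ "monom 1 j"] by (simp add: mult_monom)

lemma monom_0_mem_monomial_algebra: "monom 1 0 \<in> monomial_algebra ds"
  unfolding monomial_algebra_def monom_0 by (rule real_subalgebra.const)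

lemma monomial_algebra_eq:
  "monomial_algebra ds = supported_on {i. monom 1 i \<in> monomial_algebra ds}" (is "?R = supported_on ?E")
proof (intro equalityI subsetI)
  fix f assume "f \<in> ?R"
  then have "f \<in> real_subalgebra (monom 1 ` set ds)" by (simp add: monomial_algebra_def)
  then show "f \<in> supported_on ?E"
  proof induction
    case (const a)
    show ?case using monom_0_mem_monomial_algebra by (intro supported_on_const) simp
  next
    case (gen g)
    then show ?case using monom_mem_monomial_algebra by auto
  next
    case (add p q)
    then show ?case by (intro supported_on_add)
  next
    case (mult p q)
    show ?case unfolding supported_on_def
    proof (intro CollectI allI impI)
      fix i assume "coeff (p * q) i \<noteq> 0"
      then obtain j where "j \<le> i" "coeff p j * coeff q (i - j) \<noteq> 0"
        unfolding coeff_mult by (meson atMost_iff sum.not_neutral_contains_not_neutral)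
      then have "monom 1 j \<in> ?R" "monom 1 (i - j) \<in> ?R" "i = j + (i - j)"
        using mult.IH by (auto simp: supported_on_def)
      then show "monom 1 i \<in> ?R" using monom_add_mem_monomial_algebra by metis
    qed
  qed
next
  fix f assume f: "f \<in> supported_on ?E"
  have "(\<Sum>i\<in>A. monom (coeff f i) i) \<in> ?R" if "finite A" for A
    using that
  proof (induction A)
    case empty
    then show ?case unfolding monomial_algebra_def using real_subalgebra.const[of 0] by simp
  next
    case (insert i A)
    have "monom (coeff f i) i \<in> ?R"
    proof (cases "coeff f i = 0")
      case True
      then show ?thesis unfolding monomial_algebra_def using real_subalgebra.const[of 0] by simp
    next
      case False
      then have "monom 1 i \<in> ?R" using f by (auto simp: supported_on_def)
      then have "[:coeff f i:] * monom 1 i \<in> ?R"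
        unfolding monomial_algebra_def by (intro real_subalgebra.mult real_subalgebra.const)
      then show ?thesis by (simp add: smult_monom)
    qed
    with insert show ?case unfolding monomial_algebra_def by (auto intro: real_subalgebra.add)
  qed
  from this[of "{..degree f}"] show "f \<in> ?R" by (simp add: poly_as_sum_of_monoms)
qed

lemma conductor_tail:
  assumes "Gcd (set ds) = 1" "c = conductor (monomial_algebra ds)"
  shows "{c..} \<subseteq> {i. monom 1 i \<in> monomial_algebra ds}"
proof -
  let ?E = "{i. monom 1 i \<in> monomial_algebra ds}"
  obtain b where "{b..} \<subseteq> ?E"
  proof (rule cofinite_if_Gcd_1[of ?E "set ds"])
    show "0 \<in> ?E" using monom_0_mem_monomial_algebra by simp
    show "i + j \<in> ?E" if "i \<in> ?E" "j \<in> ?E" for i j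
      using that monom_add_mem_monomial_algebra by simp
    show "set ds \<subseteq> ?E" using monom_mem_monomial_algebra by blast
  qed (rule assms(1))
  then have "\<forall>d\<ge>b. monom 1 d \<in> monomial_algebra ds" by auto
  then have "\<forall>d\<ge>c. monom 1 d \<in> monomial_algebra ds"
    unfolding assms(2) conductor_def by (rule LeastI)
  then show ?thesis by auto
qed

lemma descartes_number_supported_on:
  fixes E :: "nat set" and j :: nat
  assumes "0 \<in> E"
  defines "D \<equiv> descartes_number (supported_on E) j"
  shows "\<And>f. f \<in> supported_on E \<Longrightarrow> f \<noteq> 0 \<Longrightarrow> degree f \<le> j \<Longrightarrow> card {x. poly f x = 0} \<le> D"
    and "\<exists>f\<in>supported_on E. f \<noteq> 0 \<and> degree f \<le> j \<and> card {x. poly f x = 0} = D"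
    and "D \<le> j"
proof -
  let ?A = "{card {x. poly f x = 0} | f. f \<in> deg_le (supported_on E) j \<and> f \<noteq> 0}"
  have D: "D = Max ?A" by (simp add: D_def descartes_number_def)
  have le: "?A \<subseteq> {..j}" using card_poly_roots_bound le_trans by (fastforce simp: deg_le_def)
  then have fin: "finite ?A" by (rule finite_subset) simp
  have "card {x. poly (1::real poly) x = 0} \<in> ?A"
    using assms(1) by (intro CollectI exI[of _ 1]) (auto simp: deg_le_def)
  then have "D \<in> ?A" unfolding D by (intro Max_in fin) auto
  then show "\<exists>f\<in>supported_on E. f \<noteq> 0 \<and> degree f \<le> j \<and> card {x. poly f x = 0} = D" "D \<le> j"
    using le by (auto simp: deg_le_def)
  show "card {x. poly f x = 0} \<le> D" if "f \<in> supported_on E" "f \<noteq> 0" "degree f \<le> j" for f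
    unfolding D using that by (intro Max_ge fin) (auto simp: deg_le_def)
qed

section \<open>The number of point evaluations\<close>

theorem theorem3p7:
  fixes ds :: "nat list" and R :: "real poly set" and c D k :: nat
  assumes "Gcd (set ds) = 1"
    and "R = monomial_algebra ds"
    and "c = conductor R"
    and "D = descartes_number R c"
    and "k \<ge> c"
  shows "(\<forall>L. moment_functional_on (deg_le R (2 * k)) L \<longrightarrow>
            (\<exists>S. finite S \<and> int (card S) \<le> int k + 1 - \<lceil>(real c - real D - 1) / 2\<rceil> \<and>
                 conic_comb_of_evals_on (deg_le R (2 * k)) S L)) \<and>
         (\<exists>L. moment_functional_on (deg_le R (2 * k)) L \<and>
            \<not> (\<exists>S. finite S \<and> int (card S) < int k - (int c - int D) \<and>
                 conic_comb_of_evals_on (deg_le R (2 * k)) S L))"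
proof -
  define E where "E = {i. monom 1 i \<in> R}"
  have R: "R = supported_on E" unfolding E_def assms(2) by (rule monomial_algebra_eq)
  have E: "0 \<in> E" "{c..} \<subseteq> E" "\<And>i j. i \<in> E \<Longrightarrow> j \<in> E \<Longrightarrow> i + j \<in> E"
    using monom_0_mem_monomial_algebra conductor_tail[OF assms(1)] monom_add_mem_monomial_algebra assms(3)
    unfolding E_def assms(2) by auto
  have V: "deg_le R (2 * k) = supported_on (E \<inter> {..2*k})" unfolding R by (rule deg_le_supported_on)
  have D_eq: "D = descartes_number (supported_on E) c" using assms(4) R by simp
  have D: "card {x. poly f x = 0} \<le> D" if "f \<in> supported_on E" "f \<noteq> 0" "degree f \<le> c" for f
    unfolding D_eq using E(1) that by (rule descartes_number_supported_on(1))
  have "D \<le> c" unfolding D_eq using E(1) by (rule descartes_number_supported_on(3))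
  show ?thesis unfolding V
  proof (intro conjI allI impI)
    fix L assume L: "moment_functional_on (supported_on (E \<inter> {..2*k})) L"
    obtain Z where Z: "finite Z" "2 * card Z + c \<le> D + 2 * k + 2"
      "conic_comb_of_evals_on (supported_on (E \<inter> {..2*k})) Z L"
      using moment_functional_few_atoms[OF E(1,2) assms(5) \<open>D \<le> c\<close> _ L] D by blast
    have "\<lceil>(real c - real D - 1) / 2\<rceil> \<le> int k + 1 - int (card Z)"
      using Z(2) by (intro ceiling_le) simp
    with Z(1,3) show "\<exists>S. finite S \<and> int (card S) \<le> int k + 1 - \<lceil>(real c - real D - 1) / 2\<rceil> \<and>
         conic_comb_of_evals_on (supported_on (E \<inter> {..2*k})) S L"
      by (intro exI[of _ Z]) auto
  next
    obtain f0 where f0: "f0 \<in> supported_on E" "f0 \<noteq> 0" "degree f0 \<le> c" "D \<le> card {x. poly f0 x = 0}"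
      using descartes_number_supported_on(2)[OF E(1), of c] unfolding D_eq by auto
    obtain f where f: "f \<in> supported_on E" "f \<noteq> 0" "degree f \<le> k" "D + (k - c) \<le> card {x. poly f x = 0}"
      using number_of_zeros_attained[OF E(1,2) f0, of "k - c"] assms(5) by auto
    let ?L = "\<lambda>g. \<Sum>z | poly f z = 0. poly g z"
    have "int k - (int c - int D) \<le> int (card S)"
      if "finite S" "conic_comb_of_evals_on (supported_on (E \<inter> {..2*k})) S ?L" for S
    proof -
      have "card {x. poly f x = 0} \<le> card S"
        by (intro card_mono that(1) zeros_subset_of_atoms[OF E assms(5) f(1-3) that])
      then show ?thesis using f(4) assms(5) by simp
    qed
    then show "\<exists>L. moment_functional_on (supported_on (E \<inter> {..2*k})) L \<and>
       \<not> (\<exists>S. finite S \<and> int (card S) < int k - (int c - int D) \<and>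
            conic_comb_of_evals_on (supported_on (E \<inter> {..2*k})) S L)"
      by (intro exI[of _ ?L] conjI moment_functional_sum_of_evals poly_roots_finite f(2)) force
  qed
qed

end
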